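(* Let $X$ be a complex manifold with $\dim_{\mathbb{C}} X = n > 1$ and let $\Omega \subset X$ be a relatively compact Stein domain. Then the boundary $\partial \Omega$ of $\Omega$ in $X$ is connected.
   Context: A domain is a non-empty connected open subset; it is relatively compact if its closure in $X$ is compact. A Stein domain is a domain that is a Stein manifold with the complex structure induced from $X$. The manifold $X$ itself is not assumed to be Stein, and no regularity of the boundary $\partial\Omega$ is assumed. *)

theory Defs
  imports "HOL-Analysis.Analysis"
begin

text \<open>Complex differentiability at every point of \<^term>\<open>S\<close>: the real derivative is required to be
  a complex linear form. Used for open \<^term>\<open>S\<close> only.\<close>

definition cn_holomorphic_on :: "(complex ^ 'n \<Rightarrow> complex) \<Rightarrow> (complex ^ 'n) set \<Rightarrow> bool" where
  "cn_holomorphic_on f S \<longleftrightarrow>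
     (\<forall>z\<in>S. \<exists>a :: complex ^ 'n. (f has_derivative (\<lambda>h. \<Sum>i\<in>UNIV. a $ i * h $ i)) (at z))"

definition cn_holomorphic_map_on ::
    "(complex ^ 'n \<Rightarrow> complex ^ 'm) \<Rightarrow> (complex ^ 'n) set \<Rightarrow> bool" where
  "cn_holomorphic_map_on F S \<longleftrightarrow> (\<forall>i. cn_holomorphic_on (\<lambda>z. F z $ i) S)"

text \<open>A chart is its domain together with the coordinate map; the values of the map outside
  the domain are irrelevant.\<close>

type_synonym ('a, 'n) chart = "'a set \<times> ('a \<Rightarrow> complex ^ 'n)"

definition chart_of :: "'a topology \<Rightarrow> ('a, 'n::finite) chart \<Rightarrow> bool" where
  "chart_of X = (\<lambda>(U, \<phi>). openin X U \<and> open (\<phi> ` U) \<and>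
     homeomorphic_map (subtopology X U) (subtopology euclidean (\<phi> ` U)) \<phi>)"

definition compatible_charts :: "('a, 'n::finite) chart \<Rightarrow> ('a, 'n::finite) chart \<Rightarrow> bool" where
  "compatible_charts = (\<lambda>(U, \<phi>) (V, \<psi>).
     cn_holomorphic_map_on (\<psi> \<circ> inv_into U \<phi>) (\<phi> ` (U \<inter> V)) \<and>
     cn_holomorphic_map_on (\<phi> \<circ> inv_into V \<psi>) (\<psi> ` (U \<inter> V)))"

text \<open>The complex structure is given by an atlas, which need not be maximal.
  Manifolds are not assumed to be connected.\<close>

definition complex_manifold :: "'a topology \<Rightarrow> ('a, 'n::finite) chart set \<Rightarrow> bool" where
  "complex_manifold X A \<longleftrightarrow>
     Hausdorff_space X \<and> second_countable X \<and>
     (\<forall>c\<in>A. chart_of X c) \<and> (\<Union>c\<in>A. fst c) = topspace X \<and>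
     (\<forall>c\<in>A. \<forall>d\<in>A. compatible_charts c d)"

definition induced_atlas :: "('a, 'n::finite) chart set \<Rightarrow> 'a set \<Rightarrow> ('a, 'n::finite) chart set" where
  "induced_atlas A W = (\<lambda>(U, \<phi>). (U \<inter> W, \<phi>)) ` A"

text \<open>The functions holomorphic on the manifold covered by the atlas; they are total functions
  whose values outside the manifold are irrelevant.\<close>

definition holomorphic_functions :: "('a, 'n::finite) chart set \<Rightarrow> ('a \<Rightarrow> complex) set" where
  "holomorphic_functions A =
     {f. \<forall>(U, \<phi>)\<in>A. cn_holomorphic_on (f \<circ> inv_into U \<phi>) (\<phi> ` U)}"

text \<open>The condition says that \<open>\<bar>f x\<bar>\<close> is at most the supremum of \<open>\<bar>f\<bar>\<close> over \<^term>\<open>K\<close>. Bounds are used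
  instead of \<^term>\<open>Sup\<close>, which is unspecified for the empty set; the hull of the empty set is empty.\<close>

definition holomorphic_hull :: "'a topology \<Rightarrow> ('a, 'n::finite) chart set \<Rightarrow> 'a set \<Rightarrow> 'a set" where
  "holomorphic_hull X A K =
     {x \<in> topspace X. \<forall>f \<in> holomorphic_functions A.
        \<forall>r::real. (\<forall>y\<in>K. norm (f y) \<le> r) \<longrightarrow> norm (f x) \<le> r}"

definition holomorphically_convex :: "'a topology \<Rightarrow> ('a, 'n::finite) chart set \<Rightarrow> bool" where
  "holomorphically_convex X A \<longleftrightarrow>
     (\<forall>K. compactin X K \<longrightarrow> compactin X (holomorphic_hull X A K))"

definition holomorphically_separable :: "'a topology \<Rightarrow> ('a, 'n::finite) chart set \<Rightarrow> bool" where
  "holomorphically_separable X A \<longleftrightarrow>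
     (\<forall>x\<in>topspace X. \<forall>y\<in>topspace X. x \<noteq> y \<longrightarrow> (\<exists>f\<in>holomorphic_functions A. f x \<noteq> f y))"

text \<open>Near every point some \<open>n = CARD('n)\<close> globally holomorphic functions form a coordinate system,
  that is, restrict to a chart belonging to the complex structure.\<close>

definition has_global_coordinates :: "'a topology \<Rightarrow> ('a, 'n::finite) chart set \<Rightarrow> bool" where
  "has_global_coordinates X A \<longleftrightarrow>
     (\<forall>p\<in>topspace X. \<exists>F :: 'a \<Rightarrow> complex ^ 'n.
        (\<forall>i. (\<lambda>x. F x $ i) \<in> holomorphic_functions A) \<and>
        (\<exists>U. p \<in> U \<and> chart_of X (U, F) \<and> (\<forall>c\<in>A. compatible_charts (U, F) c)))"

text \<open>Stein's axioms, as in Hoermander, An Introduction to Complex Analysis in Several Variables,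
  Definition 5.1.3. Second countability is part of \<^const>\<open>complex_manifold\<close>.\<close>

definition stein_manifold :: "'a topology \<Rightarrow> ('a, 'n::finite) chart set \<Rightarrow> bool" where
  "stein_manifold X A \<longleftrightarrow>
     complex_manifold X A \<and> holomorphically_convex X A \<and>
     holomorphically_separable X A \<and> has_global_coordinates X A"

definition domain_in :: "'a topology \<Rightarrow> 'a set \<Rightarrow> bool" where
  "domain_in X W \<longleftrightarrow> openin X W \<and> W \<noteq> {} \<and> connectedin X W"

definition relatively_compact_in :: "'a topology \<Rightarrow> 'a set \<Rightarrow> bool" where
  "relatively_compact_in X W \<longleftrightarrow> W \<subseteq> topspace X \<and> compactin X (X closure_of W)"

definition stein_domain_in :: "'a topology \<Rightarrow> ('a, 'n::finite) chart set \<Rightarrow> 'a set \<Rightarrow> bool" where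
  "stein_domain_in X A W \<longleftrightarrow>
     domain_in X W \<and> stein_manifold (subtopology X W) (induced_atlas A W)"

end

theory Submission
  imports Defs "HOL-Complex_Analysis.Conformal_Mappings"
begin

text \<open>
  A Stein manifold of dimension \<open>n > 1\<close> has one end; separating two pieces of \<open>\<partial>\<Omega>\<close> by disjoint open sets
  would give \<open>\<Omega>\<close> two ends. To join two points far out, take a finite sum \<open>\<phi> = \<Sum> \<bar>f i\<bar>\<^sup>2\<close> of holomorphic
  functions exceeding 1 on the boundary of a large compact set and small on the given compact set, and let
  \<open>c\<^sub>0\<close> be the infimum of the levels \<open>c\<close> at which \<open>\<phi> > c\<close> separates the points. It suffices that, near
  each point \<open>p\<close> with \<open>\<phi> p = c\<^sub>0\<close>, the set \<open>\<phi> > c\<^sub>0\<close> stays within one component, for then the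
  separation persists slightly below \<open>c\<^sub>0\<close>.

  This local statement replaces Morse theory and needs no nondegeneracy. With
  \<open>Q = \<Sum> cnj (f i p) (f i - f i p)\<close> one has \<open>\<phi> - \<phi> p = \<Sum> \<bar>f i - f i p\<bar>\<^sup>2 + 2 Re Q\<close>. As \<open>n > 1\<close>, there is
  a disc \<open>w \<mapsto> p + w v + w\<^sup>2 u\<close> along which \<open>Q\<close> is \<open>o(w\<^sup>2)\<close>, so \<open>\<phi> > \<phi> p\<close> on it away from \<open>p\<close>.
  The translates of this disc fill a neighbourhood of \<open>p\<close>, their boundary circles stay in \<open>\<phi> > \<phi> p\<close>, and
  on each of them the maximum principle joins every point of \<open>\<phi> > \<phi> p\<close> to the boundary circle.
\<close>

section \<open>Second-order expansion along complex lines\<close>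

lemma norm_vector_smult: "norm (c *s v) = norm c * norm v" for v :: "complex ^ 'n"
  by (simp add: norm_vec_def vector_scalar_mult_def norm_mult L2_set_right_distrib)

lemma has_derivative_vec:
  fixes f :: "'a::real_normed_vector \<Rightarrow> 'i::finite \<Rightarrow> complex"
  assumes "\<And>i. ((\<lambda>x. f x i) has_derivative (\<lambda>h. f' h i)) (at x within S)"
  shows "((\<lambda>x. \<chi> i. f x i) has_derivative (\<lambda>h. \<chi> i. f' h i)) (at x within S)"
  unfolding has_derivative_componentwise_within[of "\<lambda>x. \<chi> i. f x i"]
  using has_derivative_inner_left[OF assms] by (auto simp: Basis_vec_def inner_axis)

text \<open>The chain rule composes two complex linear derivatives. Restriction to curves is what
  makes the Cauchy, Taylor and maximum modulus theorems of one variable available in several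
  variables.\<close>

lemma cn_holomorphic_on_curve:
  assumes f: "cn_holomorphic_on f W" and \<gamma>: "\<And>w. w \<in> D \<Longrightarrow> \<gamma> w \<in> W" and "open D"
    and hol: "\<And>i. (\<lambda>w. \<gamma> w $ i) holomorphic_on D"
  shows "(\<lambda>w. f (\<gamma> w)) holomorphic_on D"
proof (rule holomorphic_onI)
  fix w assume w: "w \<in> D"
  obtain a where a: "(f has_derivative (\<lambda>h. \<Sum>i\<in>UNIV. a $ i * h $ i)) (at (\<gamma> w))"
    using f \<gamma>[OF w] by (auto simp: cn_holomorphic_on_def)
  define g where "g i = deriv (\<lambda>w. \<gamma> w $ i) w" for i
  have "((\<lambda>w. \<gamma> w $ i) has_derivative (\<lambda>h. g i * h)) (at w)" for i
    using holomorphic_derivI[OF hol \<open>open D\<close> w] by (simp add: g_def has_field_derivative_def)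
  then have "((\<lambda>w. \<chi> i. \<gamma> w $ i) has_derivative (\<lambda>h. \<chi> i. g i * h)) (at w)"
    by (intro has_derivative_vec)
  then have \<gamma>': "(\<gamma> has_derivative (\<lambda>h. \<chi> i. g i * h)) (at w)"
    by simp
  have "((\<lambda>w. f (\<gamma> w)) has_derivative (\<lambda>h. (\<Sum>i\<in>UNIV. a $ i * g i) * h)) (at w)"
    using has_derivative_compose[OF \<gamma>' a] by (simp add: sum_distrib_right mult.assoc)
  then show "(\<lambda>w. f (\<gamma> w)) field_differentiable at w within D"
    unfolding has_field_derivative_def[symmetric]
    using field_differentiable_at_within field_differentiable_def by blast
qed

lemma cn_holomorphic_on_imp_continuous_on:
  "cn_holomorphic_on f W \<Longrightarrow> continuous_on W f"
  using has_derivative_continuous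
  by (fastforce simp: cn_holomorphic_on_def intro!: continuous_at_imp_continuous_on)

lemma cn_holomorphic_on_subset:
  "cn_holomorphic_on f W \<Longrightarrow> V \<subseteq> W \<Longrightarrow> cn_holomorphic_on f V"
  by (auto simp: cn_holomorphic_on_def)

section \<open>Cauchy and Taylor estimates with uniform constants\<close>

text \<open>Cauchy's inequality on the circle of radius \<open>R/4\<close> about \<open>x\<close>,
  which stays inside \<open>ball 0 R\<close> because \<open>norm x < R / 2\<close>.\<close>

lemma higher_deriv_bound_half:
  assumes k: "k holomorphic_on ball 0 R" and "R > 0"
    and M: "\<And>w. w \<in> ball 0 R \<Longrightarrow> norm (k w) \<le> M" and x: "norm x < R / 2"
  shows "norm ((deriv ^^ n) k x) \<le> fact n * M / (R/4)^n"
proof (rule Cauchy_inequality)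
  have sub: "cball x (R/4) \<subseteq> ball 0 R"
  proof
    fix y assume "y \<in> cball x (R/4)"
    then have "dist x y \<le> R/4" by simp
    then show "y \<in> ball 0 R"
      using x \<open>R > 0\<close> dist_triangle[of 0 y x] by (simp add: dist_commute)
  qed
  show "k holomorphic_on ball x (R/4)"
    using holomorphic_on_subset[OF k] sub ball_subset_cball by blast
  show "continuous_on (cball x (R/4)) k"
    using holomorphic_on_subset[OF k sub] holomorphic_on_imp_continuous_on by blast
  show "norm (k y) \<le> M" if "norm (x - y) = R/4" for y
    using M[of y] sub that by (auto simp: dist_norm)
qed (use \<open>R > 0\<close> in auto)

text \<open>The constant depends on \<open>k\<close> only through the bound \<open>M\<close>. This
  uniformity over families of functions is what the limits below rely on.\<close>

lemma taylor_bound_half: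
  assumes k: "k holomorphic_on ball 0 R" and "R > 0"
    and M: "\<And>w. w \<in> ball 0 R \<Longrightarrow> norm (k w) \<le> M" and w: "norm w < R / 2"
  shows "norm (k w - (\<Sum>i\<le>n. (deriv ^^ i) k 0 * w ^ i / fact i))
          \<le> fact (Suc n) * M / (R/4)^(Suc n) * norm w ^ Suc n / fact n"
proof -
  have "norm ((deriv ^^ 0) k w - (\<Sum>i\<le>n. (deriv ^^ i) k 0 * (w - 0) ^ i / fact i))
       \<le> fact (Suc n) * M / (R/4)^(Suc n) * norm (w - 0) ^ Suc n / fact n"
  proof (rule complex_Taylor[of "ball 0 (R/2)" n "\<lambda>i. (deriv ^^ i) k"])
    fix i x assume "x \<in> ball (0::complex) (R/2)"
    then have "x \<in> ball 0 R" using \<open>R > 0\<close> by auto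
    then show "((deriv ^^ i) k has_field_derivative (deriv ^^ Suc i) k x) (at x within ball 0 (R/2))"
      using holomorphic_derivI[OF holomorphic_higher_deriv[OF k open_ball], of x i "ball 0 (R/2)"]
      by simp
  next
    fix x assume "x \<in> ball (0::complex) (R/2)"
    then show "norm ((deriv ^^ Suc n) k x) \<le> fact (Suc n) * M / (R / 4) ^ Suc n"
      using higher_deriv_bound_half[OF k \<open>R > 0\<close> M, of x "Suc n"] by simp
  qed (use w \<open>R > 0\<close> in auto)
  then show ?thesis by simp
qed

section \<open>The second-order coefficient as a function of the direction\<close>

text \<open>The quadratic Taylor term of \<open>Q\<close> at \<open>p\<close> in the direction
  \<open>z\<close>, that is, half the complex Hessian form. Taking derivatives in one variable
  avoids second derivatives in several; of the quadratic form, only homogeneity and holomorphy along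
  complex lines are established below.\<close>

definition hess :: "(complex ^ 'n \<Rightarrow> complex) \<Rightarrow> complex ^ 'n \<Rightarrow> complex ^ 'n \<Rightarrow> complex" where
  "hess Q p z = (deriv ^^ 2) (\<lambda>w. Q (p + w *s z)) 0 / 2"

lemma line_in_ball:
  fixes z :: "complex ^ 'n"
  assumes "norm z \<le> Z" "norm w < \<rho> / (Z + 1)" "\<rho> > 0"
  shows "p + w *s z \<in> ball p \<rho>"
proof -
  have Z: "Z \<ge> 0" using assms(1) norm_ge_zero order_trans by blast
  have "norm w * norm z \<le> norm w * (Z + 1)" using assms(1) by (intro mult_left_mono) auto
  also have "\<dots> < \<rho>" using assms(2) Z by (simp add: pos_less_divide_eq)
  finally show ?thesis by (simp add: dist_norm norm_vector_smult)
qed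

lemma has_field_derivative_line:
  fixes p z :: "complex ^ 'n"
  assumes a: "(Q has_derivative (\<lambda>h. \<Sum>i\<in>UNIV. a $ i * h $ i)) (at p)"
  shows "((\<lambda>w. Q (p + w *s z)) has_field_derivative (\<Sum>i\<in>UNIV. a $ i * z $ i)) (at 0)"
proof -
  have "((\<lambda>w. \<chi> i. p $ i + w * z $ i) has_derivative (\<lambda>h. \<chi> i. h * z $ i)) (at 0)"
    by (intro has_derivative_vec) (auto intro!: derivative_eq_intros)
  then have line: "((\<lambda>w. p + w *s z) has_derivative (\<lambda>h. \<chi> i. h * z $ i)) (at 0)"
    by (simp add: plus_vec_def vector_scalar_mult_def)
  have "((\<lambda>w. Q (p + w *s z)) has_derivative (\<lambda>h. \<Sum>i\<in>UNIV. a $ i * (h * z $ i))) (at 0)"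
    using has_derivative_compose[OF line, of Q "\<lambda>h. \<Sum>i\<in>UNIV. a $ i * h $ i"] a by simp
  moreover have "(\<lambda>h. \<Sum>i\<in>UNIV. a $ i * (h * z $ i)) = (*) (\<Sum>i\<in>UNIV. a $ i * z $ i)"
    by (simp add: fun_eq_iff sum_distrib_left sum_distrib_right mult_ac)
  ultimately show ?thesis
    by (simp add: has_field_derivative_def)
qed

text \<open>For all directions of norm at most \<open>Z\<close>, the disc of radius
  \<open>\<rho> / (Z + 1)\<close> is mapped into the ball, where \<open>Q\<close> is bounded by
  \<open>M\<close>. Hence the second-order Taylor bound holds with constants independent of the
  direction.\<close>

lemma taylor_along_lines:
  assumes Q: "cn_holomorphic_on Q (ball p \<rho>)" and "\<rho> > 0"
    and M: "\<And>z. z \<in> ball p \<rho> \<Longrightarrow> norm (Q z) \<le> M"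
    and a: "(Q has_derivative (\<lambda>h. \<Sum>i\<in>UNIV. a $ i * h $ i)) (at p)"
  shows "\<exists>R C. R > 0 \<and> (\<forall>z w. norm z \<le> Z \<longrightarrow> norm w < R \<longrightarrow>
     norm (Q (p + w *s z) - Q p - w * (\<Sum>i\<in>UNIV. a $ i * z $ i) - hess Q p z * w\<^sup>2) \<le> C * norm w ^ 3)"
proof (cases "Z \<ge> 0")
  case False
  then have "\<not> norm z \<le> Z" for z :: "complex ^ 'n"
    using norm_ge_zero[of z] by linarith
  then show ?thesis by (intro exI[of _ 1]) auto
next
  case True
  define R where "R = \<rho> / (Z + 1)"
  have R: "R > 0" using True \<open>\<rho> > 0\<close> by (simp add: R_def)
  have "norm (Q (p + w *s z) - Q p - w * (\<Sum>i\<in>UNIV. a $ i * z $ i) - hess Q p z * w\<^sup>2)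
           \<le> (fact 3 * M / (R/4)^3 / 2) * norm w ^ 3" if z: "norm z \<le> Z" and w: "norm w < R/2" for z w
  proof -
    define k where "k w = Q (p + w *s z)" for w
    have inb: "p + w *s z \<in> ball p \<rho>" if "w \<in> ball 0 R" for w
      using line_in_ball[OF z _ \<open>\<rho> > 0\<close>, of w p] that by (simp add: R_def)
    have k: "k holomorphic_on ball 0 R"
      unfolding k_def by (rule cn_holomorphic_on_curve[OF Q inb]) (auto intro!: holomorphic_intros)
    have tb: "norm (k w - (\<Sum>i\<le>2. (deriv ^^ i) k 0 * w ^ i / fact i))
          \<le> fact (Suc 2) * M / (R/4)^(Suc 2) * norm w ^ Suc 2 / fact 2"
      by (rule taylor_bound_half[OF k R _ w]) (use M inb in \<open>auto simp: k_def\<close>)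
    have "k = (\<lambda>w. Q (p + w *s z))" by (simp add: k_def fun_eq_iff)
    then have d: "deriv k 0 = (\<Sum>i\<in>UNIV. a $ i * z $ i)"
      using has_field_derivative_line[OF a] DERIV_imp_deriv by metis
    have sum2: "(\<Sum>i\<le>2. g i) = g 0 + g (Suc 0) + g 2" for g :: "nat \<Rightarrow> complex"
      by (simp add: eval_nat_numeral)
    have hess: "hess Q p z = (deriv ^^ 2) k 0 / 2"
      by (simp add: hess_def k_def[abs_def])
    have "k w - (\<Sum>i\<le>2. (deriv ^^ i) k 0 * w ^ i / fact i)
        = k w - k 0 - w * (\<Sum>i\<in>UNIV. a $ i * z $ i) - hess Q p z * w\<^sup>2"
      by (simp add: sum2 d hess fact_2)
    moreover have "fact (Suc 2) * M / (R/4)^(Suc 2) * norm w ^ Suc 2 / fact 2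
        = fact 3 * M / (R/4)^3 / 2 * norm w ^ 3"
      by (simp add: fact_2)
    ultimately show ?thesis
      using tb by (simp only:) (simp add: k_def)
  qed
  then show ?thesis using R by (intro exI[of _ "R/2"] exI[of _ "fact 3 * M / (R/4)^3 / 2"]) auto
qed

text \<open>In a direction annihilated by the differential the expansion starts with the square of
  \<open>w\<close>, and division leaves an error of order \<open>norm w\<close>.\<close>

lemma hess_limit:
  assumes Q: "cn_holomorphic_on Q (ball p \<rho>)" and "\<rho> > 0"
    and M: "\<And>z. z \<in> ball p \<rho> \<Longrightarrow> norm (Q z) \<le> M"
    and Q0: "Q p = 0" and a: "(Q has_derivative (\<lambda>h. \<Sum>i\<in>UNIV. a $ i * h $ i)) (at p)"
    and z: "(\<Sum>i\<in>UNIV. a $ i * z $ i) = 0"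
  shows "((\<lambda>w. Q (p + w *s z) / w\<^sup>2) \<longlongrightarrow> hess Q p z) (at 0)"
proof -
  obtain R C where "R > 0" and RC0: "\<And>z' w. norm z' \<le> norm z \<Longrightarrow> norm w < R \<Longrightarrow>
     norm (Q (p + w *s z') - Q p - w * (\<Sum>i\<in>UNIV. a $ i * z' $ i) - hess Q p z' * w\<^sup>2) \<le> C * norm w ^ 3"
    using taylor_along_lines[OF Q \<open>\<rho> > 0\<close> M a, of "norm z"] by blast
  have RC: "norm (Q (p + w *s z) - hess Q p z * w\<^sup>2) \<le> C * norm w ^ 3" if "norm w < R" for w
    using RC0[OF order_refl that] Q0 z by simp
  have "((\<lambda>w. Q (p + w *s z) / w\<^sup>2 - hess Q p z) \<longlongrightarrow> 0) (at 0)"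
  proof (rule Lim_null_comparison)
    show "((\<lambda>w::complex. C * norm w) \<longlongrightarrow> 0) (at 0)"
      by (auto intro!: tendsto_eq_intros)
    have "norm (Q (p + w *s z) / w\<^sup>2 - hess Q p z) \<le> C * norm w" if "norm w < R" "w \<noteq> 0" for w
    proof -
      have "Q (p + w *s z) / w\<^sup>2 - hess Q p z = (Q (p + w *s z) - hess Q p z * w\<^sup>2) / w\<^sup>2"
        using that by (simp add: field_simps)
      then show ?thesis
        using RC[OF that(1)] that(2)
        by (simp add: norm_divide norm_power divide_le_eq power2_eq_square power3_eq_cube mult.assoc norm_mult)
    qed
    then show "\<forall>\<^sub>F w in at 0. norm (Q (p + w *s z) / w\<^sup>2 - hess Q p z) \<le> C * norm w"
      unfolding eventually_at using \<open>R > 0\<close> by (auto intro!: exI[of _ R] simp: dist_norm)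
  qed
  then show ?thesis by (simp add: LIM_zero_iff)
qed

text \<open>Substitution of \<open>w * t\<close> for \<open>w\<close> in the limit of
  \<open>hess_limit\<close>, which applies to every direction because the derivative at
  \<open>p\<close> vanishes.\<close>

lemma hess_smult:
  assumes "cn_holomorphic_on Q (ball p \<rho>)" "\<rho> > 0" "\<And>z. z \<in> ball p \<rho> \<Longrightarrow> norm (Q z) \<le> M"
    and "Q p = 0" and "(Q has_derivative (\<lambda>h. 0)) (at p)"
  shows "hess Q p (t *s z) = t\<^sup>2 * hess Q p z"
proof (cases "t = 0")
  case True
  then show ?thesis by (simp add: hess_def eval_nat_numeral)
next
  case False
  note lim = hess_limit[OF assms(1-4), of 0, simplified, OF assms(5)]
  have "filterlim (\<lambda>w. w * t) (at 0) (at 0)"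
    using False by (intro filterlim_atI) (auto intro!: tendsto_eq_intros simp: eventually_at_filter)
  from filterlim_compose[OF lim[of z] this]
  have "((\<lambda>w. Q (p + (w * t) *s z) / (w * t)\<^sup>2) \<longlongrightarrow> hess Q p z) (at 0)" .
  then have "((\<lambda>w. t\<^sup>2 * (Q (p + (w * t) *s z) / (w * t)\<^sup>2)) \<longlongrightarrow> t\<^sup>2 * hess Q p z) (at 0)"
    by (intro tendsto_intros)
  moreover have "t\<^sup>2 * (Q (p + (w * t) *s z) / (w * t)\<^sup>2) = Q (p + w *s (t *s z)) / w\<^sup>2" for w
    using False by (simp add: power_mult_distrib vector_smult_assoc)
  ultimately have "((\<lambda>w. Q (p + w *s (t *s z)) / w\<^sup>2) \<longlongrightarrow> t\<^sup>2 * hess Q p z) (at 0)"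
    by simp
  then show ?thesis
    using LIM_unique lim by blast
qed

text \<open>As \<open>w\<close> tends to 0, the quotients
  \<open>Q (p + w *s (x + t *s y)) / w\<^sup>2\<close> are holomorphic in \<open>t\<close> and
  converge uniformly on discs to the second-order coefficient.\<close>

lemma hess_holomorphic:
  fixes x y :: "complex ^ 'n"
  assumes Q: "cn_holomorphic_on Q (ball p \<rho>)" and "\<rho> > 0"
    and M: "\<And>z. z \<in> ball p \<rho> \<Longrightarrow> norm (Q z) \<le> M"
    and Q0: "Q p = 0" and Q': "(Q has_derivative (\<lambda>h. 0)) (at p)"
  shows "(\<lambda>t. hess Q p (x + t *s y)) holomorphic_on UNIV"
proof -
  have "(\<lambda>t. hess Q p (x + t *s y)) holomorphic_on ball 0 T" for T
  proof -
    define Z where "Z = norm x + \<bar>T\<bar> * norm y"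
    have Z: "norm (x + t *s y) \<le> Z" if "t \<in> cball 0 T" for t
    proof -
      have "norm (x + t *s y) \<le> norm x + norm t * norm y"
        by (metis norm_triangle_ineq norm_vector_smult)
      also have "norm t * norm y \<le> \<bar>T\<bar> * norm y"
        using that by (intro mult_right_mono) auto
      finally show ?thesis by (simp add: Z_def)
    qed
    obtain R C where "R > 0" and RC: "\<And>z w. norm z \<le> Z \<Longrightarrow> norm w < R \<Longrightarrow>
       norm (Q (p + w *s z) - hess Q p z * w\<^sup>2) \<le> C * norm w ^ 3"
      using taylor_along_lines[OF Q \<open>\<rho> > 0\<close> M, of 0 Z] Q' Q0 by auto
    have "Z \<ge> 0" by (simp add: Z_def)
    define f where "f w t = Q (p + w *s (x + t *s y)) / w\<^sup>2" for w t
    \<comment> \<open>Small enough for the Taylor estimate and for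
      \<open>p + w *s (x + t *s y)\<close> to stay in the ball for all \<open>t\<close> in the
      closed disc.\<close>
    define R' where "R' = min R (\<rho> / (Z + 1))"
    have "R' > 0" using \<open>R > 0\<close> \<open>\<rho> > 0\<close> \<open>Z \<ge> 0\<close> by (simp add: R'_def)
    have near: "\<forall>\<^sub>F w in at (0::complex). norm w < r \<and> w \<noteq> 0" if "r > 0" for r
      unfolding eventually_at using that by (auto intro!: exI[of _ r] simp: dist_norm)
    have Qc: "continuous_on (ball p \<rho>) Q" by (rule cn_holomorphic_on_imp_continuous_on[OF Q])
    have 1: "continuous_on (cball 0 T) (f w) \<and> f w holomorphic_on ball 0 T" if w: "norm w < R' \<and> w \<noteq> 0" for w :: complex
    proof -
      have inb: "p + w *s (x + t *s y) \<in> ball p \<rho>" if "t \<in> cball 0 T" for t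
        using line_in_ball[OF Z[OF that] _ \<open>\<rho> > 0\<close>, of w p] w by (simp add: R'_def)
      have "(\<lambda>t. Q (p + w *s (x + t *s y))) holomorphic_on ball 0 T"
        by (rule cn_holomorphic_on_curve[OF Q inb]) (auto intro!: holomorphic_intros)
      moreover have "continuous_on (cball 0 T) (\<lambda>t. p + w *s (x + t *s y))"
        unfolding vector_scalar_mult_def by (auto intro!: continuous_intros)
      then have "continuous_on (cball 0 T) (\<lambda>t. Q (p + w *s (x + t *s y)))"
        by (rule continuous_on_compose2[OF Qc]) (use inb in auto)
      ultimately show ?thesis
        unfolding f_def using w by (auto intro!: holomorphic_intros continuous_intros)
    qed
    have 2: "uniform_limit (cball 0 T) f (\<lambda>t. hess Q p (x + t *s y)) (at 0)"
    proof (rule uniform_limitI)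
      fix e :: real assume "e > 0"
      define r where "r = min R (e / (\<bar>C\<bar> + 1))"
      have "r > 0" using \<open>R > 0\<close> \<open>e > 0\<close> by (simp add: r_def)
      show "\<forall>\<^sub>F w in at 0. \<forall>t\<in>cball 0 T. dist (f w t) (hess Q p (x + t *s y)) < e"
      proof (rule eventually_mono[OF near[OF \<open>r > 0\<close>]], intro ballI)
        fix w t :: complex assume w: "norm w < r \<and> w \<noteq> 0" and t: "t \<in> cball (0::complex) T"
        have "f w t - hess Q p (x + t *s y) = (Q (p + w *s (x + t *s y)) - hess Q p (x + t *s y) * w\<^sup>2) / w\<^sup>2"
          using w by (simp add: f_def field_simps)
        then have "norm (f w t - hess Q p (x + t *s y)) \<le> C * norm w"
          using RC[OF Z[OF t], of w] w
          by (simp add: r_def norm_divide norm_power divide_le_eq power2_eq_square power3_eq_cube mult.assoc norm_mult)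
        also have "\<dots> \<le> (\<bar>C\<bar> + 1) * norm w" by (intro mult_right_mono) auto
        also have "\<dots> < (\<bar>C\<bar> + 1) * (e / (\<bar>C\<bar> + 1))"
          using w by (intro mult_strict_left_mono) (auto simp: r_def)
        finally show "dist (f w t) (hess Q p (x + t *s y)) < e" by (simp add: dist_norm)
      qed
    qed
    show ?thesis
      by (rule holomorphic_uniform_limit[OF _ 2]) (use eventually_mono[OF near[OF \<open>R' > 0\<close>] 1] in auto)
  qed
  then have "(\<lambda>t. hess Q p (x + t *s y)) field_differentiable at t" for t
    using holomorphic_on_imp_differentiable_at[of _ "ball 0 (norm t + 1)"] by auto
  then show ?thesis by (simp add: holomorphic_on_def)
qed

text \<open>Two independent directions suffice: without a zero, the entire function
  \<open>t \<mapsto> hess Q p (x + t y)\<close> would grow like \<open>t\<^sup>2\<close>, contradicting Liouville's theorem.\<close>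

lemma isotropic_vector_exists:
  fixes x y :: "complex ^ 'n"
  assumes Q: "cn_holomorphic_on Q (ball p \<rho>)" and "\<rho> > 0"
    and M: "\<And>z. z \<in> ball p \<rho> \<Longrightarrow> norm (Q z) \<le> M"
    and Q0: "Q p = 0" and Q': "(Q has_derivative (\<lambda>h. 0)) (at p)"
  shows "hess Q p y = 0 \<or> (\<exists>t. hess Q p (x + t *s y) = 0)"
proof (rule disjCI)
  assume no: "\<nexists>t. hess Q p (x + t *s y) = 0"
  show "hess Q p y = 0"
  proof (rule ccontr)
    assume y: "hess Q p y \<noteq> 0"
    note hol = hess_holomorphic[OF assms]
    \<comment> \<open>By homogeneity, \<open>hess Q p (x + t *s y)\<close> is
      \<open>t\<^sup>2\<close> times \<open>hess Q p (y + inverse t *s x)\<close>, so continuity at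
      \<open>y\<close> in the direction \<open>x\<close> governs the growth at infinity.\<close>
    have "isCont (\<lambda>s. hess Q p (y + s *s x)) 0"
      using hol[of y x] holomorphic_on_imp_continuous_on continuous_on_eq_continuous_at by blast
    then have "((\<lambda>s. hess Q p (y + s *s x)) \<longlongrightarrow> hess Q p y) (at 0)"
      by (simp add: isCont_def)
    then have lim: "((\<lambda>t. hess Q p (y + inverse t *s x)) \<longlongrightarrow> hess Q p y) at_infinity"
      by (rule filterlim_compose) (simp add: at_to_infinity filterlim_def)
    have sq: "filterlim (\<lambda>t::complex. t\<^sup>2) at_infinity at_infinity"
      by (intro filterlim_power_at_infinity filterlim_ident) auto
    have "filterlim (\<lambda>t. hess Q p (y + inverse t *s x) * t\<^sup>2) at_infinity at_infinity"
      by (rule tendsto_mult_filterlim_at_infinity[OF lim y sq])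
    then have "filterlim (\<lambda>t. hess Q p (x + t *s y)) at_infinity at_infinity"
    proof (rule filterlim_cong[THEN iffD1, OF refl refl, rotated])
      have "hess Q p (y + inverse t *s x) * t\<^sup>2 = hess Q p (x + t *s y)" if "t \<noteq> 0" for t
        using hess_smult[OF assms, of t "y + inverse t *s x"] that
        by (simp add: vector_add_ldistrib vector_smult_assoc add.commute mult.commute)
      then show "\<forall>\<^sub>F t in at_infinity. hess Q p (y + inverse t *s x) * t\<^sup>2 = hess Q p (x + t *s y)"
        unfolding eventually_at_infinity by (metis norm_zero not_one_le_zero)
    qed
    then have "\<forall>\<^sub>F t in at_infinity. B \<le> norm (hess Q p (x + t *s y))" for B
      by (auto simp: filterlim_at_infinity_conv_norm_at_top filterlim_at_top)
    then obtain z where "hess Q p (x + z *s y) = 0"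
      using Liouville_weak_inverse[OF hol[of x y]] by blast
    then show False using no by blast
  qed
qed

section \<open>Discs along which a holomorphic function vanishes beyond second order\<close>

text \<open>If the differential vanishes, \<open>v\<close> is an isotropic vector of the
  second-order coefficient and \<open>u = 0\<close>. Otherwise \<open>v\<close> is taken in the
  kernel of the differential, and \<open>u\<close> is chosen so that the first-order effect of
  \<open>w\<^sup>2 *s u\<close> cancels the second-order effect of \<open>w *s v\<close>. Both
  choices of \<open>v\<close> use a second coordinate direction.\<close>

lemma tangent_curve_exists:
  fixes Q :: "complex ^ 'n \<Rightarrow> complex"
  assumes n: "CARD('n) > 1" and Q: "cn_holomorphic_on Q (ball p \<rho>)" and "\<rho> > 0" and Q0: "Q p = 0"
  shows "\<exists>v u. v \<noteq> 0 \<and> ((\<lambda>w. Q (p + w *s v + w\<^sup>2 *s u) / w\<^sup>2) \<longlongrightarrow> 0) (at 0)"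
proof -
  \<comment> \<open>Shrinking to a compact ball supplies both the bound \<open>M\<close> and uniform
    continuity of \<open>Q\<close>.\<close>
  define r where "r = \<rho> / 2"
  have "r > 0" and sub: "cball p r \<subseteq> ball p \<rho>" using \<open>\<rho> > 0\<close> by (auto simp: r_def)
  have Qr: "cn_holomorphic_on Q (ball p r)"
    using cn_holomorphic_on_subset[OF Q] sub ball_subset_cball by blast
  have Qc: "continuous_on (cball p r) Q"
    using cn_holomorphic_on_imp_continuous_on[OF cn_holomorphic_on_subset[OF Q sub]] .
  obtain M where "\<forall>y\<in>Q ` cball p r. norm y \<le> M"
    using compact_imp_bounded[OF compact_continuous_image[OF Qc compact_cball]] bounded_iff by blast
  then have M: "norm (Q z) \<le> M" if "z \<in> ball p r" for z
    using that by auto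
  obtain a where a: "(Q has_derivative (\<lambda>h. \<Sum>i\<in>UNIV. a $ i * h $ i)) (at p)"
    using Qr[unfolded cn_holomorphic_on_def, rule_format, of p] \<open>r > 0\<close> by auto
  show ?thesis
  proof (cases "\<exists>i. a $ i \<noteq> 0")
    case False
    then have a0: "(Q has_derivative (\<lambda>h. 0)) (at p)" using a by simp
    obtain i j :: 'n where ij: "i \<noteq> j"
      using n card_le_Suc0_iff_eq[of "UNIV :: 'n set"] by auto
    \<comment> \<open>\<open>y\<close> and every \<open>x + t *s y\<close> are nonzero, so either
      alternative of \<open>isotropic_vector_exists\<close> gives a nonzero
      \<open>v\<close>.\<close>
    define x y :: "complex ^ 'n" where "x = axis i 1" and "y = axis j 1"
    have ne: "y \<noteq> 0" "x + t *s y \<noteq> 0" for t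
      using ij by (auto simp: x_def y_def axis_def vec_eq_iff)
    then obtain v where "v \<noteq> 0" "hess Q p v = 0"
      using isotropic_vector_exists[OF Qr \<open>r > 0\<close> M Q0 a0, of y x] by blast
    then show ?thesis
      using hess_limit[OF Qr \<open>r > 0\<close> M Q0 a, of v] False
      by (intro exI[of _ v] exI[of _ 0]) simp
  next
    case True
    then obtain i where i: "a $ i \<noteq> 0" by blast
    have "\<exists>j. j \<noteq> i"
    proof (rule ccontr)
      assume "\<nexists>j. j \<noteq> i"
      then have "(UNIV :: 'n set) = {i}" by auto
      then have "CARD('n) = card {i}" by (rule arg_cong)
      then show False using n by simp
    qed
    then obtain j where ij: "j \<noteq> i" by blast
    define v where "v = axis j (a $ i) - axis i (a $ j)"
    have "v $ j \<noteq> 0" using i ij by (simp add: v_def axis_def)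
    then have "v \<noteq> 0" by auto
    have sum_axis: "(\<Sum>k\<in>UNIV. a $ k * axis l c $ k) = a $ l * c" for l c
      by (simp add: axis_def if_distrib[of "\<lambda>x. _ * x"] cong: if_cong)
    have av: "(\<Sum>k\<in>UNIV. a $ k * v $ k) = 0"
      by (simp add: v_def right_diff_distrib sum_subtractf sum_axis)
    define u where "u = axis i (- hess Q p v / a $ i)"
    have au: "(\<Sum>k\<in>UNIV. a $ k * u $ k) = - hess Q p v"
      using i by (simp add: u_def sum_axis)
    \<comment> \<open>The interaction between the two displacements; it remains to show that it is
      negligible against \<open>w\<^sup>2\<close>.\<close>
    define G where "G w = Q (p + w *s v + w\<^sup>2 *s u) - Q (p + w *s v) - Q (p + w\<^sup>2 *s u)" for w
    have l1: "((\<lambda>w. Q (p + w *s v) / w\<^sup>2) \<longlongrightarrow> hess Q p v) (at 0)"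
      by (rule hess_limit[OF Qr \<open>r > 0\<close> M Q0 a av])
    have "((\<lambda>w. Q (p + w *s u) / w) \<longlongrightarrow> - hess Q p v) (at 0)"
      using has_field_derivative_line[OF a, of u] Q0 by (simp add: DERIV_def au)
    moreover have "filterlim (\<lambda>w::complex. w\<^sup>2) (at 0) (at 0)"
      by (intro filterlim_atI) (auto intro!: tendsto_eq_intros simp: eventually_at_filter)
    ultimately have l2: "((\<lambda>w. Q (p + w\<^sup>2 *s u) / w\<^sup>2) \<longlongrightarrow> - hess Q p v) (at 0)"
      by (rule filterlim_compose)
    have l3: "((\<lambda>w. G w / w\<^sup>2) \<longlongrightarrow> 0) (at 0)"
    proof (rule tendstoI)
      fix e :: real assume "e > 0"
      define R where "R = r / 2 / (norm u + 1)"
      have un: "norm u + 1 > 0" using norm_ge_zero[of u] by linarith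
      have "R > 0" using \<open>r > 0\<close> un by (simp add: R_def)
      \<comment> \<open>The Cauchy estimate on \<open>ball 0 R\<close> has the constant
        \<open>4 / R\<close>, so a bound \<open>e'\<close> on the function turns into the factor
        \<open>e / 2\<close>, strictly below \<open>e\<close>.\<close>
      define e' where "e' = e * R / 8"
      have "e' > 0" using \<open>e > 0\<close> \<open>R > 0\<close> by (simp add: e'_def)
      obtain d where "d > 0" and d: "\<And>z z'. z \<in> cball p r \<Longrightarrow> z' \<in> cball p r \<Longrightarrow> dist z' z < d \<Longrightarrow> dist (Q z') (Q z) < e'"
        using compact_uniformly_continuous[OF Qc compact_cball] \<open>e' > 0\<close>
        unfolding uniformly_continuous_on_def by metis
      define s where "s = min d (r/2) / (norm v + 1)"
      have vn: "norm v + 1 > 0" using norm_ge_zero[of v] by linarith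
      have "s > 0" using vn \<open>d > 0\<close> \<open>r > 0\<close> by (simp add: s_def)
      have bound: "dist (G w / w\<^sup>2) 0 < e" if w: "norm w < s" "norm (w\<^sup>2) < R / 2" "w \<noteq> 0" for w
      proof -
        have "norm w * norm v \<le> norm w * (norm v + 1)" by (intro mult_left_mono) auto
        also have "\<dots> < min d (r/2)" using w(1) vn by (simp add: s_def pos_less_divide_eq)
        finally have wv: "norm (w *s v) < min d (r/2)" by (simp add: norm_vector_smult)
        \<comment> \<open>\<open>G w\<close> equals \<open>g (w\<^sup>2) - g 0\<close> because
          \<open>Q p = 0\<close>. Uniform continuity makes \<open>g\<close> small on a disc whose
          radius does not depend on \<open>w\<close>; the Taylor bound of order 0 then gives a small
          multiple of \<open>norm (w\<^sup>2)\<close>.\<close>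
        define g where "g b = Q (p + w *s v + b *s u) - Q (p + b *s u)" for b
        have bu: "norm (b *s u) < r/2" if "b \<in> ball 0 R" for b
        proof -
          have "norm b * norm u \<le> norm b * (norm u + 1)" by (intro mult_left_mono) auto
          also have "\<dots> < r/2" using that unfolding pos_less_divide_eq[OF un, symmetric] by (simp add: R_def)
          finally show ?thesis by (simp add: norm_vector_smult)
        qed
        have inb: "p + w *s v + b *s u \<in> ball p r" "p + b *s u \<in> ball p r" if "b \<in> ball 0 R" for b
        proof -
          have "dist p (p + x) = norm x" for x by (simp add: dist_norm)
          moreover have "norm (w *s v + b *s u) < r"
            using bu[OF that] wv norm_triangle_ineq[of "w *s v" "b *s u"] by linarith
          ultimately show "p + w *s v + b *s u \<in> ball p r" "p + b *s u \<in> ball p r"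
            using bu[OF that] \<open>r > 0\<close> by (simp_all add: add.assoc)
        qed
        have "g holomorphic_on ball 0 R"
          unfolding g_def
          by (intro holomorphic_on_diff; rule cn_holomorphic_on_curve[OF Qr inb(1)]
                cn_holomorphic_on_curve[OF Qr inb(2)]) (auto intro!: holomorphic_intros)
        moreover have "norm (g b) \<le> e'" if "b \<in> ball 0 R" for b
        proof -
          have "dist (p + w *s v + b *s u) (p + b *s u) < d"
            using wv by (simp add: dist_norm)
          then have "dist (Q (p + w *s v + b *s u)) (Q (p + b *s u)) < e'"
            using inb[OF that] ball_subset_cball by (intro d) blast+
          then show ?thesis by (simp add: g_def dist_norm)
        qed
        ultimately have "norm (g (w\<^sup>2) - (\<Sum>i\<le>0. (deriv ^^ i) g 0 * (w\<^sup>2) ^ i / fact i))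
             \<le> fact (Suc 0) * e' / (R/4)^(Suc 0) * norm (w\<^sup>2) ^ Suc 0 / fact 0"
          using \<open>R > 0\<close> w(2) by (intro taylor_bound_half) auto
        moreover have "g (w\<^sup>2) - g 0 = G w" using Q0 by (simp add: g_def G_def)
        ultimately have "norm (G w) \<le> e / 2 * norm (w\<^sup>2)"
          using \<open>R > 0\<close> by (simp add: e'_def)
        also have "\<dots> < e * norm (w\<^sup>2)" using \<open>e > 0\<close> w(3) by simp
        finally show ?thesis using w(3) by (simp add: norm_divide divide_less_eq)
      qed
      have "((\<lambda>w::complex. norm (w\<^sup>2)) \<longlongrightarrow> 0) (at 0)" "((\<lambda>w::complex. norm w) \<longlongrightarrow> 0) (at 0)"
        by (auto intro!: tendsto_eq_intros)
      from order_tendstoD(2)[OF this(1), of "R / 2"] order_tendstoD(2)[OF this(2) \<open>s > 0\<close>]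
      have "\<forall>\<^sub>F w::complex in at 0. norm (w\<^sup>2) < R / 2" "\<forall>\<^sub>F w::complex in at 0. norm w < s"
        using \<open>R > 0\<close> by simp_all
      moreover have "\<forall>\<^sub>F w::complex in at 0. w \<noteq> 0" by (simp add: eventually_at_filter)
      ultimately show "\<forall>\<^sub>F w in at 0. dist (G w / w\<^sup>2) 0 < e"
        by eventually_elim (use bound in blast)
    qed
    have "((\<lambda>w. Q (p + w *s v) / w\<^sup>2 + Q (p + w\<^sup>2 *s u) / w\<^sup>2 + G w / w\<^sup>2)
        \<longlongrightarrow> hess Q p v + - hess Q p v + 0) (at 0)"
      by (intro tendsto_add l1 l2 l3)
    moreover have "Q (p + w *s v) / w\<^sup>2 + Q (p + w\<^sup>2 *s u) / w\<^sup>2 + G w / w\<^sup>2 = Q (p + w *s v + w\<^sup>2 *s u) / w\<^sup>2" for w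
      by (simp add: G_def flip: add_divide_distrib)
    ultimately show ?thesis
      using \<open>v \<noteq> 0\<close> by (intro exI[of _ v] exI[of _ u]) simp
  qed
qed

section \<open>Superlevel sets of sums of squares\<close>

lemma cn_holomorphic_on_const: "cn_holomorphic_on (\<lambda>z. c) W"
  unfolding cn_holomorphic_on_def by (intro ballI exI[of _ 0]) simp

lemma cn_holomorphic_on_add:
  assumes "cn_holomorphic_on f W" "cn_holomorphic_on g W"
  shows "cn_holomorphic_on (\<lambda>z. f z + g z) W"
  unfolding cn_holomorphic_on_def
proof
  fix z assume "z \<in> W"
  then obtain a b where "(f has_derivative (\<lambda>h. \<Sum>i\<in>UNIV. a $ i * h $ i)) (at z)"
    "(g has_derivative (\<lambda>h. \<Sum>i\<in>UNIV. b $ i * h $ i)) (at z)"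
    using assms[unfolded cn_holomorphic_on_def] by blast
  from has_derivative_add[OF this]
  have "((\<lambda>z. f z + g z) has_derivative (\<lambda>h. \<Sum>i\<in>UNIV. (a + b) $ i * h $ i)) (at z)"
    by (simp add: algebra_simps sum.distrib)
  then show "\<exists>c. ((\<lambda>z. f z + g z) has_derivative (\<lambda>h. \<Sum>i\<in>UNIV. c $ i * h $ i)) (at z)" ..
qed

lemma cn_holomorphic_on_mult:
  assumes "cn_holomorphic_on f W" "cn_holomorphic_on g W"
  shows "cn_holomorphic_on (\<lambda>z. f z * g z) W"
  unfolding cn_holomorphic_on_def
proof
  fix z assume "z \<in> W"
  then obtain a b where "(f has_derivative (\<lambda>h. \<Sum>i\<in>UNIV. a $ i * h $ i)) (at z)"
    "(g has_derivative (\<lambda>h. \<Sum>i\<in>UNIV. b $ i * h $ i)) (at z)"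
    using assms[unfolded cn_holomorphic_on_def] by blast
  from has_derivative_mult[OF this]
  have "((\<lambda>z. f z * g z) has_derivative (\<lambda>h. \<Sum>i\<in>UNIV. (f z *s b + g z *s a) $ i * h $ i)) (at z)"
    by (simp add: algebra_simps sum.distrib sum_distrib_left)
  then show "\<exists>c. ((\<lambda>z. f z * g z) has_derivative (\<lambda>h. \<Sum>i\<in>UNIV. c $ i * h $ i)) (at z)" ..
qed

lemma cn_holomorphic_on_sum:
  assumes "finite I" "\<And>i. i \<in> I \<Longrightarrow> cn_holomorphic_on (f i) W"
  shows "cn_holomorphic_on (\<lambda>z. \<Sum>i\<in>I. f i z) W"
  using assms by (induction I) (simp_all add: cn_holomorphic_on_const cn_holomorphic_on_add)

text \<open>For holomorphic \<open>a\<close> and constant \<open>b\<close> this splits the increment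
  into a nonnegative part and the real part of a holomorphic function.\<close>

lemma sum_norm_square_expansion:
  fixes a b :: "'i \<Rightarrow> complex"
  shows "(\<Sum>i\<in>I. (norm (a i))\<^sup>2) =
    (\<Sum>i\<in>I. (norm (b i))\<^sup>2) + (\<Sum>i\<in>I. (norm (a i - b i))\<^sup>2) + 2 * Re (\<Sum>i\<in>I. cnj (b i) * (a i - b i))"
proof -
  have eq: "(norm x)\<^sup>2 = (norm y)\<^sup>2 + (norm (x - y))\<^sup>2 + 2 * Re (cnj y * (x - y))" for x y :: complex
    unfolding cmod_power2 by (simp add: power2_eq_square algebra_simps)
  have "(\<Sum>i\<in>I. (norm (a i))\<^sup>2) = (\<Sum>i\<in>I. (norm (b i))\<^sup>2 + (norm (a i - b i))\<^sup>2
      + 2 * Re (cnj (b i) * (a i - b i)))"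
    by (intro sum.cong refl eq)
  then show ?thesis
    by (simp add: sum.distrib sum_distrib_left)
qed

text \<open>Since \<open>\<Sum> cnj (f i 0) f i\<close> is holomorphic, the maximum modulus principle and
  Cauchy-Schwarz give the maximum principle for \<open>\<Sum> \<bar>f i\<bar>\<^sup>2\<close>.\<close>

lemma superlevel_component_reaches_sphere:
  fixes f :: "'i \<Rightarrow> complex \<Rightarrow> complex"
  assumes I: "finite I" and "r > 0"
    and hol: "\<And>i. i \<in> I \<Longrightarrow> f i holomorphic_on ball 0 r"
    and cont: "\<And>i. i \<in> I \<Longrightarrow> continuous_on (cball 0 r) (f i)"
    and c: "(\<Sum>i\<in>I. (norm (f i 0))\<^sup>2) > c" "c \<ge> 0"
  defines "U \<equiv> {w \<in> ball 0 r. (\<Sum>i\<in>I. (norm (f i w))\<^sup>2) > c}"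
  shows "closure (connected_component_set U 0) \<inter> sphere 0 r \<noteq> {}"
proof
  assume empty: "closure (connected_component_set U 0) \<inter> sphere 0 r = {}"
  define G where "G = connected_component_set U 0"
  define \<phi> where "\<phi> w = (\<Sum>i\<in>I. (norm (f i w))\<^sup>2)" for w
  have \<phi>c: "continuous_on (cball 0 r) \<phi>"
    unfolding \<phi>_def by (intro continuous_intros cont)
  have U: "U = {w \<in> ball 0 r. \<phi> w > c}" by (simp add: U_def \<phi>_def)
  have "open U"
  proof -
    have "open (ball 0 r \<inter> \<phi> -` {c<..})"
      by (rule continuous_open_preimage) (use continuous_on_subset[OF \<phi>c ball_subset_cball] in auto)
    then show ?thesis by (simp add: U vimage_def Int_def)
  qed
  have "0 \<in> U" using c \<open>r > 0\<close> by (simp add: U_def)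
  have "G \<subseteq> U" by (simp add: G_def connected_component_subset)
  have "open G" unfolding G_def by (rule open_connected_component[OF \<open>open U\<close>])
  have "0 \<in> G" by (simp add: G_def \<open>0 \<in> U\<close>)
  have Gr: "closure G \<subseteq> cball 0 r"
    using \<open>G \<subseteq> U\<close> by (intro closure_minimal) (auto simp: U)
  \<comment> \<open>A frontier point of \<open>G\<close> is off the circle by assumption, hence in
    the open disc. It is not in the open set \<open>U\<close>, since the frontier of a component
    lies in the frontier of \<open>U\<close>.\<close>
  have front: "\<phi> w \<le> c" "w \<in> ball 0 r" if "w \<in> frontier G" for w
  proof -
    have "w \<in> closure G" using that by (simp add: frontier_def)
    then have "w \<in> cball 0 r" "w \<notin> sphere 0 r" using Gr empty unfolding G_def by blast+
    then show b: "w \<in> ball 0 r" by auto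
    have "frontier G \<subseteq> frontier U"
      unfolding G_def by (rule frontier_of_connected_component_subset)
    then have "w \<notin> U" using that \<open>open U\<close> by (auto simp: frontier_def interior_open)
    then show "\<phi> w \<le> c" using b by (simp add: U)
  qed
  define h where "h w = (\<Sum>i\<in>I. cnj (f i 0) * f i w)" for w
  have h_front: "norm (h w) \<le> sqrt (\<phi> 0) * sqrt c" if "w \<in> frontier G" for w
  proof -
    have "norm (h w) \<le> (\<Sum>i\<in>I. \<bar>norm (f i 0)\<bar> * \<bar>norm (f i w)\<bar>)"
      unfolding h_def by (rule order_trans[OF norm_sum]) (simp add: norm_mult)
    also have "\<dots> \<le> sqrt (\<phi> 0) * sqrt (\<phi> w)"
      using L2_set_mult_ineq[of "\<lambda>i. norm (f i 0)" "\<lambda>i. norm (f i w)" I] by (simp add: L2_set_def \<phi>_def)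
    also have "\<dots> \<le> sqrt (\<phi> 0) * sqrt c"
      using front[OF that] by (intro mult_left_mono) (simp_all add: \<phi>_def sum_nonneg)
    finally show ?thesis .
  qed
  have h_hol: "h holomorphic_on interior G"
  proof -
    have "h holomorphic_on ball 0 r" unfolding h_def by (intro holomorphic_intros hol)
    then show ?thesis using \<open>G \<subseteq> U\<close> interior_subset[of G] by (elim holomorphic_on_subset) (auto simp: U)
  qed
  have h_cont: "continuous_on (closure G) h"
    unfolding h_def by (intro continuous_intros continuous_on_subset[OF cont Gr])
  have "bounded G" 
    by (rule bounded_subset[OF bounded_ball[of 0 r]]) (use \<open>G \<subseteq> U\<close> U in blast)
  have "norm (h 0) \<le> sqrt (\<phi> 0) * sqrt c"
    by (rule maximum_modulus_frontier[OF h_hol h_cont \<open>bounded G\<close> h_front \<open>0 \<in> G\<close>])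
  moreover have "h 0 = of_real (\<phi> 0)"
    unfolding h_def \<phi>_def of_real_sum complex_norm_square by (intro sum.cong refl mult.commute)
  moreover have "\<phi> 0 > c" using c by (simp add: \<phi>_def)
  \<comment> \<open>At 0 the modulus of \<open>h\<close> is \<open>\<phi> 0\<close> itself, so the
    frontier bound contradicts \<open>\<phi> 0 > c\<close>.\<close>
  ultimately have "\<phi> 0 \<le> sqrt (\<phi> 0) * sqrt c" "sqrt (\<phi> 0) * sqrt c < sqrt (\<phi> 0) * sqrt (\<phi> 0)"
    using c(2) by (simp_all add: mult_strict_left_mono del: real_sqrt_mult_self)
  then show False using \<open>\<phi> 0 > c\<close> c(2) by simp
qed

section \<open>Local connectedness of superlevel sets\<close>

text \<open>The estimate with \<open>\<delta>\<close> bounds the nonnegative part of the expansion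
  from below, so it dominates \<open>Q\<close> along the disc of
  \<open>tangent_curve_exists\<close>; the punctured disc therefore lies in \<open>E\<close>, which
  gives the closure claim. Translates of the disc then connect every point of \<open>E\<close> near
  \<open>p\<close> to one connected set formed by their boundary circles.\<close>

lemma superlevel_locally_connected:
  fixes f :: "'i \<Rightarrow> complex ^ 'n \<Rightarrow> complex"
  assumes n: "CARD('n) > 1" and W: "open W" "p \<in> W" and I: "finite I"
    and hol: "\<And>i. i \<in> I \<Longrightarrow> cn_holomorphic_on (f i) W"
    and \<delta>: "\<delta> > 0" "\<And>z. z \<in> W \<Longrightarrow> (\<Sum>i\<in>I. (norm (f i z - f i p))\<^sup>2) \<ge> \<delta> * (norm (z - p))\<^sup>2"
  defines "E \<equiv> {z \<in> W. (\<Sum>i\<in>I. (norm (f i z))\<^sup>2) > (\<Sum>i\<in>I. (norm (f i p))\<^sup>2)}"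
  shows "p \<in> closure E" "\<exists>N C. open N \<and> p \<in> N \<and> N \<subseteq> W \<and> connected C \<and> C \<subseteq> E \<and> N \<inter> E \<subseteq> C"
proof -
  define \<phi> where "\<phi> z = (\<Sum>i\<in>I. (norm (f i z))\<^sup>2)" for z
  have E: "E = {z \<in> W. \<phi> z > \<phi> p}" by (simp add: E_def \<phi>_def)
  have fc: "continuous_on W (f i)" if "i \<in> I" for i
    by (rule cn_holomorphic_on_imp_continuous_on[OF hol[OF that]])
  have \<phi>c: "continuous_on W \<phi>" unfolding \<phi>_def by (intro continuous_intros fc)
  have "open E"
  proof -
    have "open (W \<inter> \<phi> -` {\<phi> p<..})"
      by (rule continuous_open_preimage[OF \<phi>c W(1)]) auto
    then show ?thesis by (simp add: E vimage_def Int_def)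
  qed
  \<comment> \<open>Written as a sum with \<open>- f i p\<close> so that the closure rules for sums
    and constants apply directly.\<close>
  define Q where "Q z = (\<Sum>i\<in>I. cnj (f i p) * (f i z + - f i p))" for z
  have \<phi>Q: "\<phi> z \<ge> \<phi> p + \<delta> * (norm (z - p))\<^sup>2 - 2 * norm (Q z)" if "z \<in> W" for z
  proof -
    have "\<phi> z = \<phi> p + (\<Sum>i\<in>I. (norm (f i z - f i p))\<^sup>2) + 2 * Re (Q z)"
      unfolding \<phi>_def Q_def by (subst sum_norm_square_expansion[of _ I "\<lambda>i. f i p"]) simp
    moreover have "Re (Q z) \<ge> - norm (Q z)"
      using abs_Re_le_cmod[of "Q z"] by linarith
    ultimately show ?thesis using \<delta>(2)[OF that] by linarith
  qed
  have "cn_holomorphic_on Q W"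
    unfolding Q_def by (intro cn_holomorphic_on_sum cn_holomorphic_on_mult cn_holomorphic_on_add
        cn_holomorphic_on_const hol I)
  moreover obtain \<rho> where "\<rho> > 0" and \<rho>: "ball p \<rho> \<subseteq> W"
    using W open_contains_ball by blast
  ultimately have "cn_holomorphic_on Q (ball p \<rho>)"
    by (blast intro: cn_holomorphic_on_subset)
  then obtain v u where v: "v \<noteq> 0" and lim: "((\<lambda>w. Q (p + w *s v + w\<^sup>2 *s u) / w\<^sup>2) \<longlongrightarrow> 0) (at 0)"
    using tangent_curve_exists[OF n _ \<open>\<rho> > 0\<close>, of Q p] by (auto simp: Q_def)
  define \<gamma> where "\<gamma> w = w *s v + w\<^sup>2 *s u" for w
  have \<gamma>c: "continuous_on A \<gamma>" for A
    unfolding \<gamma>_def vector_scalar_mult_def by (intro continuous_intros)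
  have \<gamma>0: "\<gamma> 0 = 0" by (simp add: \<gamma>_def)
  have "isCont \<gamma> 0" using \<gamma>c[of UNIV] by (simp add: continuous_on_eq_continuous_at)
  then have \<gamma>lim: "(\<gamma> \<longlongrightarrow> 0) (at 0)" by (simp add: isCont_def \<gamma>0)
  \<comment> \<open>Below, \<open>norm (\<gamma> w) \<ge> norm w * norm v / 2\<close>, so the
    quadratic gain is at least \<open>4 * \<epsilon> * (norm w)\<^sup>2\<close>, whereas
    \<open>2 * norm (Q (p + \<gamma> w))\<close> is below half of that.\<close>
  define \<epsilon> where "\<epsilon> = \<delta> * (norm v)\<^sup>2 / 16"
  have "\<epsilon> > 0" using \<delta>(1) v by (simp add: \<epsilon>_def)
  have curve: "p + \<gamma> w \<in> E"
    if w: "w \<noteq> 0" "norm (Q (p + w *s v + w\<^sup>2 *s u) / w\<^sup>2) < \<epsilon>" "norm (\<gamma> w) < \<rho>"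
      "norm (w *s u) < norm v / 2" for w
  proof -
    have in_W: "p + \<gamma> w \<in> W" using w(3) by (intro subsetD[OF \<rho>]) (simp add: dist_norm)
    have "norm (w *s v) \<le> norm (\<gamma> w) + norm (w\<^sup>2 *s u)"
      using norm_triangle_ineq4[of "\<gamma> w" "w\<^sup>2 *s u"] by (simp add: \<gamma>_def)
    moreover have "norm (w\<^sup>2 *s u) = norm w * norm (w *s u)"
      by (simp add: norm_vector_smult power2_eq_square norm_mult)
    moreover have "norm w * norm (w *s u) \<le> norm w * (norm v / 2)"
      using w(4) by (intro mult_left_mono) auto
    ultimately have "norm w * norm v / 2 \<le> norm (\<gamma> w)"
      using norm_vector_smult[of w v] by (simp add: mult.commute)
    then have "(norm w * norm v / 2)\<^sup>2 \<le> (norm (\<gamma> w))\<^sup>2" by (intro power_mono) auto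
    then have "\<delta> * (norm w * norm v / 2)\<^sup>2 \<le> \<delta> * (norm (\<gamma> w))\<^sup>2"
      using \<delta>(1) by (intro mult_left_mono) auto
    moreover have "\<delta> * (norm w * norm v / 2)\<^sup>2 = 4 * (\<epsilon> * (norm w)\<^sup>2)"
      by (simp add: \<epsilon>_def power_mult_distrib power_divide)
    moreover have "norm (Q (p + \<gamma> w)) < \<epsilon> * (norm w)\<^sup>2"
      using w(1,2) by (simp add: norm_divide norm_power divide_less_eq \<gamma>_def add.assoc)
    moreover have "\<epsilon> * (norm w)\<^sup>2 > 0" using \<open>\<epsilon> > 0\<close> w(1) by simp
    ultimately have "\<phi> (p + \<gamma> w) > \<phi> p"
      using \<phi>Q[OF in_W] by simp
    then show ?thesis using in_W by (simp add: E)
  qed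
  have ev: "\<forall>\<^sub>F w in at 0. p + \<gamma> w \<in> E"
  proof -
    have "((\<lambda>w. norm (w *s u)) \<longlongrightarrow> 0) (at 0)"
      unfolding norm_vector_smult by (auto intro!: tendsto_eq_intros)
    from order_tendstoD(2)[OF this, of "norm v / 2"] v
    have "\<forall>\<^sub>F w in at 0. norm (w *s u) < norm v / 2" by simp
    moreover have "\<forall>\<^sub>F w in at 0. norm (Q (p + w *s v + w\<^sup>2 *s u) / w\<^sup>2) < \<epsilon>"
      using tendstoD[OF lim \<open>\<epsilon> > 0\<close>] by simp
    moreover have "\<forall>\<^sub>F w in at 0. norm (\<gamma> w) < \<rho>"
      using tendstoD[OF \<gamma>lim \<open>\<rho> > 0\<close>] by simp
    moreover have "\<forall>\<^sub>F w::complex in at 0. w \<noteq> 0" by (simp add: eventually_at_filter)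
    ultimately show ?thesis by eventually_elim (rule curve)
  qed
  show "p \<in> closure E"
    unfolding closure_approachable
  proof (intro allI impI)
    fix e :: real assume "e > 0"
    have "\<forall>\<^sub>F w in at 0. dist (p + \<gamma> w) p < e"
      using tendstoD[OF \<gamma>lim \<open>e > 0\<close>] by (simp add: dist_norm)
    with ev have "\<forall>\<^sub>F w in at (0::complex). p + \<gamma> w \<in> E \<and> dist (p + \<gamma> w) p < e"
      by eventually_elim simp
    then obtain w where "p + \<gamma> w \<in> E \<and> dist (p + \<gamma> w) p < e"
      using eventually_happens' at_neq_bot by blast
    then show "\<exists>y\<in>E. dist y p < e" by blast
  qed
  obtain r0 where "r0 > 0" and r0: "\<And>w. w \<noteq> 0 \<Longrightarrow> norm w < r0 \<Longrightarrow> p + \<gamma> w \<in> E"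
    using ev unfolding eventually_at by (auto simp: dist_norm)
  define r where "r = r0 / 2"
  have "r > 0" "r < r0" using \<open>r0 > 0\<close> by (auto simp: r_def)
  \<comment> \<open>By compactness there is room around the disc inside \<open>W\<close> and around
    its boundary circle inside \<open>E\<close>; hence one \<open>\<eta>\<close> controls all small
    translates.\<close>
  have "compact ((\<lambda>w. p + \<gamma> w) ` cball 0 r)" "compact ((\<lambda>w. p + \<gamma> w) ` sphere 0 r)"
    by (intro compact_continuous_image continuous_intros \<gamma>c compact_cball compact_sphere)+
  moreover have "(\<lambda>w. p + \<gamma> w) ` cball 0 r \<subseteq> W"
  proof safe
    fix w :: complex assume "w \<in> cball 0 r"
    then show "p + \<gamma> w \<in> W"
      using r0[of w] \<open>r < r0\<close> W(2) by (cases "w = 0") (auto simp: \<gamma>0 E)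
  qed
  moreover have "(\<lambda>w. p + \<gamma> w) ` sphere 0 r \<subseteq> E"
    using r0 \<open>r > 0\<close> \<open>r < r0\<close> by auto
  ultimately obtain \<eta>1 \<eta>2 where \<eta>: "\<eta>1 > 0" "\<eta>2 > 0"
    "(\<Union>x\<in>(\<lambda>w. p + \<gamma> w) ` cball 0 r. ball x \<eta>1) \<subseteq> W"
    "(\<Union>x\<in>(\<lambda>w. p + \<gamma> w) ` sphere 0 r. ball x \<eta>2) \<subseteq> E"
    using compact_subset_open_imp_ball_epsilon_subset W(1) \<open>open E\<close> by metis
  define \<eta> where "\<eta> = min \<eta>1 \<eta>2"
  have "\<eta> > 0" using \<eta> by (simp add: \<eta>_def)
  have disc: "p + s + \<gamma> w \<in> W" if "norm s < \<eta>" "norm w \<le> r" for s w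
  proof -
    have "p + s + \<gamma> w = (p + \<gamma> w) + s" by (simp add: algebra_simps)
    then have "p + s + \<gamma> w \<in> ball (p + \<gamma> w) \<eta>1" using that(1) by (simp add: dist_norm \<eta>_def)
    moreover have "w \<in> cball 0 r" using that(2) by simp
    ultimately show ?thesis using \<eta>(3) by blast
  qed
  have circle: "p + s + \<gamma> w \<in> E" if "norm s < \<eta>" "norm w = r" for s w
  proof -
    have "p + s + \<gamma> w = (p + \<gamma> w) + s" by (simp add: algebra_simps)
    then have "p + s + \<gamma> w \<in> ball (p + \<gamma> w) \<eta>2" using that(1) by (simp add: dist_norm \<eta>_def)
    moreover have "w \<in> sphere 0 r" using that(2) by simp
    ultimately show ?thesis using \<eta>(4) by blast
  qed
  \<comment> \<open>All translated boundary circles together. As the image of a ball times a circle,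
    this set is connected, so the choice of the translate does not matter.\<close>
  define C0 where "C0 = (\<lambda>(s, w). p + s + \<gamma> w) ` (ball 0 \<eta> \<times> sphere 0 r)"
  have "connected C0"
    unfolding C0_def
  proof (rule connected_continuous_image)
    show "continuous_on (ball 0 \<eta> \<times> sphere 0 r) (\<lambda>(s, w). p + s + \<gamma> w)"
      unfolding split_beta \<gamma>_def vector_scalar_mult_def by (intro continuous_intros)
    show "connected (ball (0::complex ^ 'n) \<eta> \<times> sphere (0::complex) r)"
      by (intro connected_Times connected_ball connected_sphere) simp
  qed
  have "C0 \<subseteq> E" using circle by (auto simp: C0_def)
  define z0 where "z0 = p + \<gamma> (of_real r)"
  have "z0 \<in> C0"
    using \<open>r > 0\<close> \<open>\<eta> > 0\<close> by (auto simp: C0_def z0_def intro!: image_eqI[of _ _ "(0, of_real r)"])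
  define C where "C = connected_component_set E z0"
  have C: "B \<subseteq> C" if "connected B" "B \<subseteq> E" "B \<inter> C0 \<noteq> {}" for B
  proof -
    have "B \<union> C0 \<subseteq> C"
      unfolding C_def using that \<open>connected C0\<close> \<open>C0 \<subseteq> E\<close> \<open>z0 \<in> C0\<close>
      by (intro connected_component_maximal connected_Un) auto
    then show ?thesis by simp
  qed
  have "ball p \<eta> \<inter> E \<subseteq> C"
  proof
    fix z assume "z \<in> ball p \<eta> \<inter> E"
    define s where "s = z - p"
    have s: "norm s < \<eta>" and zE: "p + s \<in> E"
      using \<open>z \<in> ball p \<eta> \<inter> E\<close> by (auto simp: s_def dist_norm norm_minus_commute)
    \<comment> \<open>The disc is translated so that its centre is \<open>z\<close>; this is the
      part of its interior where the sum exceeds \<open>\<phi> p\<close>.\<close>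
    define U where "U = {w \<in> ball 0 r. (\<Sum>i\<in>I. (norm (f i (p + s + \<gamma> w)))\<^sup>2) > \<phi> p}"
    have "closure (connected_component_set U 0) \<inter> sphere 0 r \<noteq> {}"
      unfolding U_def
    proof (rule superlevel_component_reaches_sphere[OF I \<open>r > 0\<close>])
      fix i assume "i \<in> I"
      show "(\<lambda>w. f i (p + s + \<gamma> w)) holomorphic_on ball 0 r"
      proof (rule cn_holomorphic_on_curve[OF hol[OF \<open>i \<in> I\<close>]])
        show "p + s + \<gamma> w \<in> W" if "w \<in> ball 0 r" for w
          using that by (intro disc[OF s]) simp
        show "(\<lambda>w. (p + s + \<gamma> w) $ k) holomorphic_on ball 0 r" for k
          by (auto intro!: holomorphic_intros simp: \<gamma>_def)
      qed simp
      show "continuous_on (cball 0 r) (\<lambda>w. f i (p + s + \<gamma> w))"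
        by (rule continuous_on_compose2[OF fc[OF \<open>i \<in> I\<close>]])
          (auto intro!: disc[OF s] continuous_intros \<gamma>c)
    next
      show "\<phi> p < (\<Sum>i\<in>I. (norm (f i (p + s + \<gamma> 0)))\<^sup>2)"
        using zE by (simp add: E \<gamma>0 \<phi>_def)
      show "0 \<le> \<phi> p" by (simp add: \<phi>_def sum_nonneg)
    qed
    then obtain w1 where "w1 \<in> closure (connected_component_set U 0)" "w1 \<in> sphere 0 r" by blast
    then have w1: "w1 \<in> closure (connected_component_set U 0)" "norm w1 = r" by auto
    \<comment> \<open>The component lies in the open disc. Adding its limit point \<open>w1\<close>
      keeps it connected and makes its image meet \<open>C0\<close>, and the image of
      \<open>w1\<close> is in \<open>E\<close> because the whole circle is.\<close>
    define G where "G = insert w1 (connected_component_set U 0)"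
    have "connected G"
      by (rule connected_intermediate_closure[of "connected_component_set U 0"])
        (use w1 closure_subset[of "connected_component_set U 0"] in \<open>auto simp: G_def\<close>)
    have "0 \<in> G"
    proof -
      have "0 \<in> U" using zE \<open>r > 0\<close> by (simp add: U_def E \<gamma>0 \<phi>_def)
      then show ?thesis by (simp add: G_def)
    qed
    have "(\<lambda>w. p + s + \<gamma> w) ` G \<subseteq> E"
    proof safe
      fix w assume "w \<in> G"
      then consider "w = w1" | "w \<in> U"
        using connected_component_subset[of U 0] by (auto simp: G_def)
      then show "p + s + \<gamma> w \<in> E"
      proof cases
        case 1
        then show ?thesis using circle[OF s w1(2)] by simp
      next
        case 2
        then show ?thesis using disc[OF s, of w] by (simp add: U_def E \<phi>_def)
      qed
    qed
    moreover have "connected ((\<lambda>w. p + s + \<gamma> w) ` G)"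
      by (intro connected_continuous_image \<open>connected G\<close> continuous_intros \<gamma>c)
    moreover have "p + s + \<gamma> w1 \<in> C0"
      using s w1(2) by (auto simp: C0_def intro!: image_eqI[of _ _ "(s, w1)"])
    then have "(\<lambda>w. p + s + \<gamma> w) ` G \<inter> C0 \<noteq> {}" by (auto simp: G_def)
    ultimately have "(\<lambda>w. p + s + \<gamma> w) ` G \<subseteq> C" by (intro C)
    moreover have "z = p + s + \<gamma> 0" by (simp add: s_def \<gamma>0)
    ultimately show "z \<in> C" using \<open>0 \<in> G\<close> by blast
  qed
  moreover have "ball p \<eta> \<subseteq> W"
  proof
    fix z assume "z \<in> ball p \<eta>"
    then show "z \<in> W" using disc[of "z - p" 0] \<open>r > 0\<close> by (simp add: \<gamma>0 dist_norm norm_minus_commute)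
  qed
  ultimately show "\<exists>N C. open N \<and> p \<in> N \<and> N \<subseteq> W \<and> connected C \<and> C \<subseteq> E \<and> N \<inter> E \<subseteq> C"
    using \<open>\<eta> > 0\<close> connected_connected_component[of E z0] connected_component_subset[of E z0]
    unfolding C_def by (intro exI[of _ "ball p \<eta>"] exI[of _ "connected_component_set E z0"]) simp
qed

section \<open>Charts and holomorphic functions\<close>

text \<open>Since \<open>U\<close> and its image are open, openness of images and preimages can be
  expressed in the ambient topologies.\<close>

lemma chart_ofD:
  assumes "chart_of X (U, \<phi>)"
  shows "openin X U" "open (\<phi> ` U)" "inj_on \<phi> U"
    and "continuous_map (subtopology X U) euclidean \<phi>"
    and "continuous_map (top_of_set (\<phi> ` U)) X (inv_into U \<phi>)"
    and "\<And>V. openin X V \<Longrightarrow> open (\<phi> ` (U \<inter> V))"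
    and "\<And>N. open N \<Longrightarrow> openin X {x \<in> U. \<phi> x \<in> N}"
proof -
  have *: "openin X U" "open (\<phi> ` U)" and
    h: "homeomorphic_map (subtopology X U) (top_of_set (\<phi> ` U)) \<phi>"
    using assms unfolding chart_of_def by simp_all
  show "openin X U" "open (\<phi> ` U)" by fact+
  have top: "topspace (subtopology X U) = U"
    using openin_subset[OF *(1)] by auto
  have "inj_on \<phi> (topspace (subtopology X U))"
    using h unfolding homeomorphic_eq_everything_map by blast
  then show inj: "inj_on \<phi> U" unfolding top .
  have om: "open_map (subtopology X U) (top_of_set (\<phi> ` U)) \<phi>"
    by (rule homeomorphic_imp_open_map[OF h])
  show cont: "continuous_map (subtopology X U) euclidean \<phi>"
    by (rule continuous_map_into_fulltopology[OF homeomorphic_imp_continuous_map[OF h]])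
  show op: "open (\<phi> ` (U \<inter> V))" if "openin X V" for V
  proof -
    have "openin (subtopology X U) (U \<inter> V)" by (rule openin_subtopology_Int2[OF that])
    then have "openin (top_of_set (\<phi> ` U)) (\<phi> ` (U \<inter> V))" using om unfolding open_map_def by blast
    then show ?thesis unfolding openin_open_eq[OF *(2)] by blast
  qed
  show "openin X {x \<in> U. \<phi> x \<in> N}" if "open N" for N
  proof -
    have "openin (subtopology X U) {x \<in> topspace (subtopology X U). \<phi> x \<in> N}"
      by (rule openin_continuous_map_preimage[OF cont]) (use that in simp)
    from openin_trans_full[OF this *(1)] show ?thesis unfolding top .
  qed
  show "continuous_map (top_of_set (\<phi> ` U)) X (inv_into U \<phi>)"
    unfolding continuous_map_def
  proof (intro conjI allI impI funcsetI)
    show "inv_into U \<phi> z \<in> topspace X" if "z \<in> topspace (top_of_set (\<phi> ` U))" for z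
      using subsetD[OF openin_subset[OF *(1)] inv_into_into[of z \<phi> U]] that by simp
    show "openin (top_of_set (\<phi> ` U)) {z \<in> topspace (top_of_set (\<phi> ` U)). inv_into U \<phi> z \<in> V}"
      if V: "openin X V" for V
    proof -
      have "{z \<in> \<phi> ` U. inv_into U \<phi> z \<in> V} = \<phi> ` (U \<inter> V)"
        by (auto simp: inv_into_f_f[OF inj])
      moreover have "openin (top_of_set (\<phi> ` U)) (\<phi> ` (U \<inter> V))"
        unfolding openin_open_eq[OF *(2)] using op[OF V] by blast
      ultimately show ?thesis by simp
    qed
  qed
qed

lemma complex_manifoldD:
  assumes "complex_manifold X A"
  shows "Hausdorff_space X" "\<And>c. c \<in> A \<Longrightarrow> chart_of X c"
    and "\<And>x. x \<in> topspace X \<Longrightarrow> \<exists>U \<phi>. (U, \<phi>) \<in> A \<and> x \<in> U"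
proof -
  show "Hausdorff_space X" using assms unfolding complex_manifold_def by blast
  show "chart_of X c" if "c \<in> A" for c
    using assms that unfolding complex_manifold_def by blast
  show "\<exists>U \<phi>. (U, \<phi>) \<in> A \<and> x \<in> U" if "x \<in> topspace X" for x
  proof -
    have "x \<in> (\<Union>c\<in>A. fst c)" using assms that unfolding complex_manifold_def by blast
    then obtain c where "c \<in> A" "x \<in> fst c" by blast
    then show ?thesis by (intro exI[of _ "fst c"] exI[of _ "snd c"]) simp
  qed
qed

text \<open>Closed coordinate balls are compact neighbourhoods. This later puts a compact
  neighbourhood around a holomorphic hull.\<close>

lemma locally_compact_space_manifold:
  assumes "complex_manifold X A"
  shows "locally_compact_space X"
  unfolding locally_compact_space_def
proof
  fix x assume "x \<in> topspace X"
  then obtain U \<phi> where A: "(U, \<phi>) \<in> A" and x: "x \<in> U"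
    using complex_manifoldD(3)[OF assms] by blast
  note ch = chart_ofD[OF complex_manifoldD(2)[OF assms A]]
  obtain e where "e > 0" and e: "cball (\<phi> x) e \<subseteq> \<phi> ` U"
    using ch(2) x open_contains_cball by blast
  define K where "K = inv_into U \<phi> ` cball (\<phi> x) e"
  have "compactin (top_of_set (\<phi> ` U)) (cball (\<phi> x) e)"
    unfolding compactin_subtopology using e by simp
  then have "compactin X K" unfolding K_def by (rule image_compactin[OF _ ch(5)])
  moreover have "{y \<in> U. \<phi> y \<in> ball (\<phi> x) e} \<subseteq> K"
  proof
    fix y assume "y \<in> {y \<in> U. \<phi> y \<in> ball (\<phi> x) e}"
    then show "y \<in> K"
      unfolding K_def using inv_into_f_f[OF ch(3), of y] by (intro image_eqI[of _ _ "\<phi> y"]) auto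
  qed
  moreover have "openin X {y \<in> U. \<phi> y \<in> ball (\<phi> x) e}" by (rule ch(7)) simp
  ultimately show "\<exists>V K. openin X V \<and> compactin X K \<and> x \<in> V \<and> V \<subseteq> K"
    using x \<open>e > 0\<close> by (intro exI[of _ "{y \<in> U. \<phi> y \<in> ball (\<phi> x) e}"] exI[of _ K]) auto
qed

text \<open>Open coordinate balls are path connected. This later replaces a connected set joining
  two points by a path, which is compact.\<close>

lemma locally_path_connected_space_manifold:
  assumes "complex_manifold X A"
  shows "locally_path_connected_space X"
  unfolding locally_path_connected_space
proof (intro allI impI)
  fix V x assume V: "openin X V \<and> x \<in> V"
  then have "x \<in> topspace X" using openin_subset by blast
  then obtain U \<phi> where A: "(U, \<phi>) \<in> A" and x: "x \<in> U"
    using complex_manifoldD(3)[OF assms] by blast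
  note ch = chart_ofD[OF complex_manifoldD(2)[OF assms A]]
  obtain e where "e > 0" and e: "ball (\<phi> x) e \<subseteq> \<phi> ` (U \<inter> V)"
    using ch(6)[of V] V x open_contains_ball by blast
  define N where "N = inv_into U \<phi> ` ball (\<phi> x) e"
  have N: "N = {y \<in> U. \<phi> y \<in> ball (\<phi> x) e}"
  proof (intro equalityI subsetI)
    fix y assume "y \<in> N"
    then obtain z where z: "z \<in> ball (\<phi> x) e" "y = inv_into U \<phi> z" unfolding N_def by blast
    moreover have "z \<in> \<phi> ` U" using z(1) e by blast
    ultimately show "y \<in> {y \<in> U. \<phi> y \<in> ball (\<phi> x) e}"
      by (simp add: inv_into_into f_inv_into_f)
  next
    fix y assume "y \<in> {y \<in> U. \<phi> y \<in> ball (\<phi> x) e}"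
    then show "y \<in> N"
      unfolding N_def using inv_into_f_f[OF ch(3), of y] by (intro image_eqI[of _ _ "\<phi> y"]) auto
  qed
  have "path_connectedin (top_of_set (\<phi> ` U)) (ball (\<phi> x) e)"
    unfolding path_connectedin_subtopology path_connectedin_euclidean
    using e by (intro conjI convex_imp_path_connected convex_ball) blast
  then have "path_connectedin X N"
    unfolding N_def by (rule path_connectedin_continuous_map_image[OF ch(5)])
  moreover have "openin X N" unfolding N by (rule ch(7)) simp
  moreover have "x \<in> N" using x \<open>e > 0\<close> by (simp add: N)
  moreover have "N \<subseteq> V"
  proof
    fix y assume "y \<in> N"
    then have "y \<in> U" "\<phi> y \<in> \<phi> ` (U \<inter> V)" using e by (auto simp: N)
    then show "y \<in> V" using inj_onD[OF ch(3)] by blast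
  qed
  ultimately show "\<exists>U. openin X U \<and> path_connectedin X U \<and> x \<in> U \<and> U \<subseteq> V" by blast
qed

section \<open>Holomorphic functions on a manifold\<close>

lemma holomorphic_functions_chart:
  assumes "f \<in> holomorphic_functions A" "(U, \<phi>) \<in> A"
  shows "cn_holomorphic_on (f \<circ> inv_into U \<phi>) (\<phi> ` U)"
  using assms by (auto simp: holomorphic_functions_def)

lemma holomorphic_functions_continuous:
  fixes A :: "('a, 'n::finite) chart set"
  assumes M: "complex_manifold X A" and f: "f \<in> holomorphic_functions A"
  shows "continuous_map X euclidean f"
  unfolding continuous_map_def
proof (intro conjI allI impI)
  fix T :: "complex set" assume "openin euclidean T"
  then have "open T" by simp
  \<comment> \<open>The part of the preimage of \<open>T\<close> visible in the chart
    \<open>c\<close>, pulled back from an open set of coordinates.\<close>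
  define B where "B c = {x \<in> fst c. snd c x \<in> snd c ` fst c \<inter> (f \<circ> inv_into (fst c) (snd c)) -` T}"
    for c :: "('a, 'n) chart"
  have "openin X (B c)" if "c \<in> A" for c
  proof -
    obtain U \<phi> where c: "c = (U, \<phi>)" by (cases c)
    note ch = chart_ofD[OF complex_manifoldD(2)[OF M that[unfolded c]]]
    have "open (\<phi> ` U \<inter> (f \<circ> inv_into U \<phi>) -` T)"
      using cn_holomorphic_on_imp_continuous_on[OF holomorphic_functions_chart[OF f that[unfolded c]]]
      by (rule continuous_open_preimage) (fact ch(2) \<open>open T\<close>)+
    then show ?thesis unfolding B_def c fst_conv snd_conv by (rule ch(7))
  qed
  then have "openin X (\<Union> (B ` A))" by blast
  moreover have "\<Union> (B ` A) = {x \<in> topspace X. f x \<in> T}"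
  proof (intro equalityI subsetI)
    fix x assume "x \<in> \<Union> (B ` A)"
    then obtain U \<phi> where c: "(U, \<phi>) \<in> A" and x: "x \<in> B (U, \<phi>)" by auto
    note ch = chart_ofD[OF complex_manifoldD(2)[OF M c]]
    have "x \<in> U" "f (inv_into U \<phi> (\<phi> x)) \<in> T" using x by (auto simp: B_def)
    then show "x \<in> {x \<in> topspace X. f x \<in> T}"
      using inv_into_f_f[OF ch(3)] openin_subset[OF ch(1)] by auto
  next
    fix x assume "x \<in> {x \<in> topspace X. f x \<in> T}"
    then have x: "x \<in> topspace X" "f x \<in> T" by auto
    then obtain U \<phi> where c: "(U, \<phi>) \<in> A" and U: "x \<in> U"
      using complex_manifoldD(3)[OF M] by blast
    note ch = chart_ofD[OF complex_manifoldD(2)[OF M c]]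
    have "x \<in> B (U, \<phi>)" using x U inv_into_f_f[OF ch(3)] by (simp add: B_def)
    then show "x \<in> \<Union> (B ` A)" using c by blast
  qed
  ultimately show "openin X {x \<in> topspace X. f x \<in> T}" by simp
qed auto

lemma cn_holomorphic_on_compose:
  assumes f: "cn_holomorphic_on f T" and G: "cn_holomorphic_map_on G S" and "G ` S \<subseteq> T"
  shows "cn_holomorphic_on (f \<circ> G) S"
  unfolding cn_holomorphic_on_def
proof
  fix z assume z: "z \<in> S"
  then obtain a where a: "(f has_derivative (\<lambda>h. \<Sum>i\<in>UNIV. a $ i * h $ i)) (at (G z))"
    using f \<open>G ` S \<subseteq> T\<close> unfolding cn_holomorphic_on_def by blast
  have "\<forall>i. \<exists>b. ((\<lambda>z. G z $ i) has_derivative (\<lambda>h. \<Sum>j\<in>UNIV. b $ j * h $ j)) (at z)"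
    using G z unfolding cn_holomorphic_map_on_def cn_holomorphic_on_def by blast
  then obtain b where b: "\<And>i. ((\<lambda>z. G z $ i) has_derivative (\<lambda>h. \<Sum>j\<in>UNIV. b i $ j * h $ j)) (at z)"
    by metis
  have "((\<lambda>z. \<chi> i. G z $ i) has_derivative (\<lambda>h. \<chi> i. \<Sum>j\<in>UNIV. b i $ j * h $ j)) (at z)"
    by (intro has_derivative_vec b)
  then have G': "(G has_derivative (\<lambda>h. \<chi> i. \<Sum>j\<in>UNIV. b i $ j * h $ j)) (at z)"
    by simp
  have "((\<lambda>z. f (G z)) has_derivative (\<lambda>h. \<Sum>i\<in>UNIV. a $ i * (\<Sum>j\<in>UNIV. b i $ j * h $ j))) (at z)"
    using has_derivative_compose[OF G' a] by simp
  moreover have "(\<Sum>i\<in>UNIV. a $ i * (\<Sum>j\<in>UNIV. b i $ j * h $ j))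
     = (\<Sum>j\<in>UNIV. (\<chi> j. \<Sum>i\<in>UNIV. a $ i * b i $ j) $ j * h $ j)" for h
    unfolding sum_distrib_left vec_lambda_beta sum_distrib_right mult.assoc by (rule sum.swap)
  ultimately have "(f \<circ> G has_derivative (\<lambda>h. \<Sum>j\<in>UNIV. (\<chi> j. \<Sum>i\<in>UNIV. a $ i * b i $ j) $ j * h $ j)) (at z)"
    by (simp only: o_def)
  then show "\<exists>c. (f \<circ> G has_derivative (\<lambda>h. \<Sum>j\<in>UNIV. c $ j * h $ j)) (at z)" ..
qed

lemma cn_holomorphic_on_cong:
  assumes "cn_holomorphic_on f S" "open S" "\<And>z. z \<in> S \<Longrightarrow> f z = g z"
  shows "cn_holomorphic_on g S"
  unfolding cn_holomorphic_on_def
proof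
  fix z assume z: "z \<in> S"
  then obtain a where "(f has_derivative (\<lambda>h. \<Sum>i\<in>UNIV. a $ i * h $ i)) (at z)"
    using assms(1) unfolding cn_holomorphic_on_def by blast
  then have "(g has_derivative (\<lambda>h. \<Sum>i\<in>UNIV. a $ i * h $ i)) (at z)"
    by (rule has_derivative_transform_within_open) (use assms z in auto)
  then show "\<exists>a. (g has_derivative (\<lambda>h. \<Sum>i\<in>UNIV. a $ i * h $ i)) (at z)" ..
qed

text \<open>On each overlap, \<open>f\<close> in the coordinates \<open>F\<close> factors through an
  atlas chart and a holomorphic transition map. The coordinate systems in
  \<open>has_global_coordinates\<close> are only required to be compatible with the atlas, so they
  are handled through this lemma.\<close>

lemma holomorphic_functions_compatible_chart:
  assumes M: "complex_manifold X A" and f: "f \<in> holomorphic_functions A"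
    and U: "chart_of X (U, F)" and compat: "\<And>c. c \<in> A \<Longrightarrow> compatible_charts (U, F) c"
  shows "cn_holomorphic_on (f \<circ> inv_into U F) (F ` U)"
proof -
  note ch = chart_ofD[OF U]
  have "cn_holomorphic_on (f \<circ> inv_into U F) (F ` (U \<inter> V))" if A: "(V, \<psi>) \<in> A" for V \<psi>
  proof (rule cn_holomorphic_on_cong)
    note ch' = chart_ofD[OF complex_manifoldD(2)[OF M A]]
    show "open (F ` (U \<inter> V))" by (rule ch(6)[OF ch'(1)])
    have "cn_holomorphic_map_on (\<psi> \<circ> inv_into U F) (F ` (U \<inter> V))"
      using compat[OF A] by (simp add: compatible_charts_def)
    moreover have "(\<psi> \<circ> inv_into U F) ` F ` (U \<inter> V) \<subseteq> \<psi> ` V"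
      using ch(3) by (auto simp: inv_into_f_f)
    ultimately show "cn_holomorphic_on ((f \<circ> inv_into V \<psi>) \<circ> (\<psi> \<circ> inv_into U F)) (F ` (U \<inter> V))"
      by (rule cn_holomorphic_on_compose[OF holomorphic_functions_chart[OF f A]])
    show "((f \<circ> inv_into V \<psi>) \<circ> (\<psi> \<circ> inv_into U F)) z = (f \<circ> inv_into U F) z" if "z \<in> F ` (U \<inter> V)" for z
      using that ch(3) ch'(3) by (auto simp: inv_into_f_f)
  qed
  moreover have "\<exists>V \<psi>. (V, \<psi>) \<in> A \<and> z \<in> F ` (U \<inter> V)" if "z \<in> F ` U" for z
    using that complex_manifoldD(3)[OF M] openin_subset[OF ch(1)] by blast
  ultimately show ?thesis
    unfolding cn_holomorphic_on_def by blast
qed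

lemma holomorphic_functions_const: "(\<lambda>x. c) \<in> holomorphic_functions A"
  by (auto simp: holomorphic_functions_def o_def cn_holomorphic_on_const)

lemma holomorphic_functions_mult:
  "f \<in> holomorphic_functions A \<Longrightarrow> g \<in> holomorphic_functions A \<Longrightarrow> (\<lambda>x. f x * g x) \<in> holomorphic_functions A"
  by (fastforce simp: holomorphic_functions_def o_def intro: cn_holomorphic_on_mult)

lemma holomorphic_functions_power:
  "f \<in> holomorphic_functions A \<Longrightarrow> (\<lambda>x. f x ^ m) \<in> holomorphic_functions A"
  by (induction m) (auto intro: holomorphic_functions_const holomorphic_functions_mult)

section \<open>Superlevel sets on a manifold\<close>

text \<open>Transport of \<open>superlevel_locally_connected\<close> through the chart
  \<open>(U, F)\<close>, with the finite set of functions serving as its own index set.\<close>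

lemma superlevel_locally_connected_manifold:
  fixes Y :: "'a topology" and B :: "('a, 'n::finite) chart set" and I :: "('a \<Rightarrow> complex) set"
  assumes n: "CARD('n) > 1" and M: "complex_manifold Y B"
    and I: "finite I" "I \<subseteq> holomorphic_functions B"
    and Z: "openin Y Z" "p \<in> Z"
    and U: "chart_of Y (U, F)" "p \<in> U" and compat: "\<And>c. c \<in> B \<Longrightarrow> compatible_charts (U, F) c"
    and \<delta>: "\<delta> > 0" "\<And>x. x \<in> U \<Longrightarrow> \<delta> * (norm (F x - F p))\<^sup>2 \<le> (\<Sum>f\<in>I. (norm (f x - f p))\<^sup>2)"
  defines "E \<equiv> {x \<in> Z. (\<Sum>f\<in>I. (norm (f x))\<^sup>2) > (\<Sum>f\<in>I. (norm (f p))\<^sup>2)}"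
  shows "p \<in> Y closure_of E"
    and "\<exists>N C. openin Y N \<and> p \<in> N \<and> N \<subseteq> Z \<and> connectedin Y C \<and> C \<subseteq> E \<and> N \<inter> E \<subseteq> C"
proof -
  note ch = chart_ofD[OF U(1)]
  have inv: "inv_into U F (F x) = x" if "x \<in> U" for x
    by (rule inv_into_f_f[OF ch(3) that])
  define W where "W = F ` (U \<inter> Z)"
  have "open W" unfolding W_def by (rule ch(6)[OF Z(1)])
  have "F p \<in> W" using U(2) Z(2) by (simp add: W_def)
  have hol: "cn_holomorphic_on (f \<circ> inv_into U F) W" if "f \<in> I" for f
    by (rule cn_holomorphic_on_subset[OF holomorphic_functions_compatible_chart[OF M _ U(1) compat]])
      (use that I in \<open>auto simp: W_def\<close>)
  have lower: "\<delta> * (norm (z - F p))\<^sup>2 \<le> (\<Sum>f\<in>I. (norm ((f \<circ> inv_into U F) z - (f \<circ> inv_into U F) (F p)))\<^sup>2)"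
    if "z \<in> W" for z
    using that \<delta>(2) U(2) inv by (auto simp: W_def)
  define E' where "E' = {z \<in> W. (\<Sum>f\<in>I. (norm ((f \<circ> inv_into U F) z))\<^sup>2) > (\<Sum>f\<in>I. (norm ((f \<circ> inv_into U F) (F p)))\<^sup>2)}"
  have E': "F x \<in> E' \<longleftrightarrow> x \<in> E" if "x \<in> U" for x
  proof -
    have "F x \<in> W \<longleftrightarrow> x \<in> Z"
      unfolding W_def using that inj_onD[OF ch(3)] by blast
    then show ?thesis using that U(2) inv by (simp add: E'_def E_def)
  qed
  have E'_U: "z \<in> F ` U" if "z \<in> E'" for z
    using that by (auto simp: E'_def W_def)
  note local = superlevel_locally_connected[where f = "\<lambda>f. f \<circ> inv_into U F" and I = I and W = W and p = "F p",
      OF n \<open>open W\<close> \<open>F p \<in> W\<close> I(1) hol \<delta>(1) lower, folded E'_def]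
  show "p \<in> Y closure_of E"
    unfolding in_closure_of
  proof (intro conjI allI impI)
    show "p \<in> topspace Y" using Z openin_subset by blast
    fix T assume T: "p \<in> T \<and> openin Y T"
    have "open (F ` (U \<inter> T))" using ch(6) T by blast
    moreover have "F p \<in> F ` (U \<inter> T)" using T U(2) by blast
    ultimately have "E' \<inter> F ` (U \<inter> T) \<noteq> {}"
      using local(1) closure_iff_nhds_not_empty by blast
    then obtain x where "x \<in> U \<inter> T" "F x \<in> E'" by blast
    then show "\<exists>y. y \<in> E \<and> y \<in> T" using E' by blast
  qed
  obtain N' C' where N': "open N'" "F p \<in> N'" "N' \<subseteq> W" and C': "connected C'" "C' \<subseteq> E'" "N' \<inter> E' \<subseteq> C'"
    using local(2) by blast
  define N where "N = {x \<in> U. F x \<in> N'}"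
  define C where "C = inv_into U F ` C'"
  have "openin Y N" unfolding N_def by (rule ch(7)[OF N'(1)])
  moreover have "p \<in> N" using U(2) N'(2) by (simp add: N_def)
  moreover have "N \<subseteq> Z"
  proof
    fix x assume "x \<in> N"
    then have "x \<in> U" "F x \<in> F ` (U \<inter> Z)" using N'(3) by (auto simp: N_def W_def)
    then show "x \<in> Z" using inj_onD[OF ch(3)] by blast
  qed
  moreover have "connectedin Y C"
  proof -
    have "connectedin (top_of_set (F ` U)) C'"
      using C' E'_U by (auto simp: connectedin_subtopology)
    then show ?thesis unfolding C_def by (rule connectedin_continuous_map_image[OF ch(5)])
  qed
  moreover have "C \<subseteq> E"
  proof
    fix x assume "x \<in> C"
    then obtain z where z: "z \<in> C'" "x = inv_into U F z" unfolding C_def by blast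
    then obtain y where "y \<in> U" "z = F y" using C'(2) E'_U by blast
    then show "x \<in> E" using z C'(2) E' inv by auto
  qed
  moreover have "N \<inter> E \<subseteq> C"
  proof
    fix x assume "x \<in> N \<inter> E"
    then have x: "x \<in> U" "F x \<in> N' \<inter> E'" using E' by (auto simp: N_def)
    then have "F x \<in> C'" using C'(3) by blast
    then show "x \<in> C" unfolding C_def using inv[OF x(1)] by (metis image_eqI)
  qed
  ultimately show "\<exists>N C. openin Y N \<and> p \<in> N \<and> N \<subseteq> Z \<and> connectedin Y C \<and> C \<subseteq> E \<and> N \<inter> E \<subseteq> C"
    by blast
qed

section \<open>Finite families of functions on a Stein manifold\<close>

text \<open>Each point of \<open>D\<close> is outside the hull, so some function exceeds 1 there and
  stays below a constant less than 1 on \<open>K\<close>. Compactness leaves finitely many such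
  functions, and a common high power makes them small on \<open>K\<close> while keeping the sum
  above 1 on \<open>D\<close>.\<close>

lemma peak_functions_exist:
  assumes "complex_manifold Y B" and K: "K \<noteq> {}" and D: "compactin Y D" "D \<inter> holomorphic_hull Y B K = {}"
  shows "\<exists>G. finite G \<and> G \<subseteq> holomorphic_functions B \<and> (\<forall>y\<in>K. (\<Sum>g\<in>G. (norm (g y))\<^sup>2) < 1 / 2) \<and>
    (\<forall>x\<in>D. (\<Sum>g\<in>G. (norm (g x))\<^sup>2) > 1)"
proof -
  define H where "H = {g \<in> holomorphic_functions B. \<exists>q<1. \<forall>y\<in>K. norm (g y) \<le> q}"
  define V where "V g = {x \<in> topspace Y. norm (g x) > 1}" for g :: "'a \<Rightarrow> complex"
  have V: "openin Y (V g)" if "g \<in> H" for g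
  proof -
    have cont: "continuous_map Y euclidean g"
      using that holomorphic_functions_continuous[OF assms(1)] by (simp add: H_def)
    have "open {z::complex. 1 < norm z}"
      by (intro open_Collect_less continuous_intros)
    then have "openin euclidean {z::complex. 1 < norm z}"
      by (rule open_openin[THEN iffD1])
    then have "openin Y {x \<in> topspace Y. g x \<in> {z. 1 < norm z}}"
      by (rule openin_continuous_map_preimage[OF cont])
    then show ?thesis by (simp add: V_def)
  qed
  have "\<exists>g\<in>H. x \<in> V g" if x: "x \<in> D" for x
  proof -
    have xt: "x \<in> topspace Y" using x D compactin_subset_topspace by blast
    have "x \<notin> holomorphic_hull Y B K" using D(2) x by blast
    then have "\<not> (\<forall>f\<in>holomorphic_functions B. \<forall>r. (\<forall>y\<in>K. norm (f y) \<le> r) \<longrightarrow> norm (f x) \<le> r)"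
      using xt unfolding holomorphic_hull_def by blast
    then obtain f r where f: "f \<in> holomorphic_functions B" "\<forall>y\<in>K. norm (f y) \<le> r" "\<not> norm (f x) \<le> r"
      by blast
    obtain y0 where "y0 \<in> K" using K by blast
    then have "r \<ge> 0" using f(2) order_trans[OF norm_ge_zero] by blast
    \<comment> \<open>A level strictly between the bound on \<open>K\<close> and the value at
      \<open>x\<close>; dividing by it puts these on opposite sides of 1. Its positivity comes from
      \<open>r \<ge> 0\<close>.\<close>
    define s where "s = (r + norm (f x)) / 2"
    have s: "s > 0" "r < s" "s < norm (f x)" using \<open>r \<ge> 0\<close> f(3) by (simp_all add: s_def)
    define g where "g x = of_real (inverse s) * f x" for x
    have ng: "norm (g y) = norm (f y) / s" for y
      using s(1) by (simp add: g_def norm_mult norm_inverse divide_inverse mult.commute)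
    have "g \<in> holomorphic_functions B"
      unfolding g_def[abs_def] by (intro holomorphic_functions_mult holomorphic_functions_const f)
    moreover have "\<forall>y\<in>K. norm (g y) \<le> r / s"
      using f(2) s(1) by (simp add: ng divide_right_mono)
    moreover have "r / s < 1" using s by simp
    ultimately have "g \<in> H" unfolding H_def by blast
    moreover have "x \<in> V g" using s xt by (simp add: V_def ng)
    ultimately show ?thesis by blast
  qed
  then have "D \<subseteq> \<Union> (V ` H)" by blast
  then obtain \<V> where "finite \<V>" "\<V> \<subseteq> V ` H" "D \<subseteq> \<Union> \<V>"
    using compactinD[OF D(1), of "V ` H"] V by blast
  then obtain G0 where G0: "finite G0" "G0 \<subseteq> H" "D \<subseteq> \<Union> (V ` G0)"
    by (metis finite_subset_image)
  \<comment> \<open>\<open>card G0\<close> summands below \<open>\<epsilon>\<close> add up to less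
    than \<open>1 / 2\<close>; the added 1 keeps this strict and covers an empty
    \<open>G0\<close>.\<close>
  define \<epsilon> :: real where "\<epsilon> = 1 / (2 * (real (card G0) + 1))"
  have "\<epsilon> > 0" by (simp add: \<epsilon>_def)
  have "\<forall>\<^sub>F m in sequentially. \<forall>y\<in>K. (norm (g y ^ m))\<^sup>2 < \<epsilon>" if g: "g \<in> G0" for g
  proof -
    obtain q where q: "q < 1" "\<forall>y\<in>K. norm (g y) \<le> q" using g G0(2) unfolding H_def by blast
    obtain y0 where "y0 \<in> K" using K by blast
    then have "q \<ge> 0" using q(2) order_trans[OF norm_ge_zero] by blast
    have "(\<lambda>m. (q ^ m)\<^sup>2) \<longlonglongrightarrow> 0"
    proof -
      have "norm q < 1" using \<open>q \<ge> 0\<close> q(1) by simp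
      from tendsto_power[OF LIMSEQ_power_zero[OF this], of 2] show ?thesis
        by (simp only: zero_power2)
    qed
    then have "\<forall>\<^sub>F m in sequentially. (q ^ m)\<^sup>2 < \<epsilon>"
      by (rule order_tendstoD(2)) (fact \<open>\<epsilon> > 0\<close>)
    then show ?thesis
    proof (rule eventually_mono, intro ballI)
      fix m y assume m: "(q ^ m)\<^sup>2 < \<epsilon>" and "y \<in> K"
      have "(norm (g y) ^ m)\<^sup>2 \<le> (q ^ m)\<^sup>2"
        using q(2) \<open>y \<in> K\<close> by (intro power_mono zero_le_power norm_ge_zero) blast
      then show "(norm (g y ^ m))\<^sup>2 < \<epsilon>" using m unfolding norm_power by (rule le_less_trans)
    qed
  qed
  then have "\<forall>\<^sub>F m in sequentially. \<forall>g\<in>G0. \<forall>y\<in>K. (norm (g y ^ m))\<^sup>2 < \<epsilon>"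
    by (rule eventually_ball_finite[OF G0(1) ballI])
  \<comment> \<open>The exponent is also required to be positive, since the power 0 would give the
    value 1 rather than more than 1 on \<open>D\<close>.\<close>
  from eventually_happens'[OF sequentially_bot eventually_conj[OF eventually_gt_at_top[of 0] this]]
  obtain m :: nat where "0 < m \<and> (\<forall>g\<in>G0. \<forall>y\<in>K. (norm (g y ^ m))\<^sup>2 < \<epsilon>)" by (rule exE)
  then have m: "m > 0" "\<And>g y. g \<in> G0 \<Longrightarrow> y \<in> K \<Longrightarrow> (norm (g y ^ m))\<^sup>2 < \<epsilon>"
    by blast+
  define G where "G = (\<lambda>g x. g x ^ m) ` G0"
  have "finite G" using G0(1) by (simp add: G_def)
  moreover have "G \<subseteq> holomorphic_functions B"
  proof
    fix h assume "h \<in> G"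
    then obtain g where "g \<in> G0" "h = (\<lambda>x. g x ^ m)" unfolding G_def by blast
    then show "h \<in> holomorphic_functions B"
      using G0(2) holomorphic_functions_power unfolding H_def by blast
  qed
  moreover have "(\<Sum>g\<in>G. (norm (g y))\<^sup>2) < 1 / 2" if "y \<in> K" for y
  proof -
    \<comment> \<open>Only an inequality, because different functions may have the same
      power.\<close>
    have "(\<Sum>g\<in>G. (norm (g y))\<^sup>2) \<le> (\<Sum>g\<in>G0. (norm (g y ^ m))\<^sup>2)"
      unfolding G_def using sum_image_le[OF G0(1), of "\<lambda>g. (norm (g y))\<^sup>2" "\<lambda>g x. g x ^ m"] by (simp add: o_def)
    also have "\<dots> \<le> (\<Sum>g\<in>G0. \<epsilon>)"
      using m(2) that by (intro sum_mono less_imp_le) blast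
    also have "\<dots> < 1 / 2" by (simp add: \<epsilon>_def divide_less_eq)
    finally show ?thesis .
  qed
  moreover have "(\<Sum>g\<in>G. (norm (g x))\<^sup>2) > 1" if x: "x \<in> D" for x
  proof -
    obtain g where g: "g \<in> G0" "x \<in> V g" using G0(3) x by blast
    have "1 < (norm (g x ^ m))\<^sup>2"
      using g(2) m(1) by (simp add: V_def norm_power one_less_power)
    also have "\<dots> \<le> (\<Sum>g\<in>G. (norm (g x))\<^sup>2)"
      by (rule member_le_sum[of "\<lambda>x. g x ^ m" G "\<lambda>g. (norm (g x))\<^sup>2"])
        (use g \<open>finite G\<close> in \<open>auto simp: G_def\<close>)
    finally show ?thesis .
  qed
  ultimately show ?thesis by blast
qed

lemma norm_vec_square: "(norm z)\<^sup>2 = (\<Sum>i\<in>UNIV. (norm (z $ i))\<^sup>2)" for z :: "complex ^ 'n"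
  by (simp add: norm_vec_def L2_set_def sum_nonneg)

lemma continuous_map_sum_norm_square:
  assumes "complex_manifold Y B" "finite I" "I \<subseteq> holomorphic_functions B"
  shows "continuous_map Y euclideanreal (\<lambda>x. \<Sum>f\<in>I. (norm (f x))\<^sup>2)"
proof (rule continuous_map_sum[OF assms(2)])
  fix f assume "f \<in> I"
  then have "continuous_map Y euclidean f"
    using assms holomorphic_functions_continuous by blast
  moreover have "continuous_map euclidean euclideanreal (\<lambda>z::complex. (norm z)\<^sup>2)"
    unfolding continuous_map_iff_continuous2 by (intro continuous_intros)
  ultimately have "continuous_map Y euclideanreal ((\<lambda>z. (norm z)\<^sup>2) \<circ> f)"
    by (rule continuous_map_compose)
  then show "continuous_map Y euclideanreal (\<lambda>x. (norm (f x))\<^sup>2)"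
    by (simp add: o_def)
qed

text \<open>Finitely many global coordinate systems cover \<open>L\<close>; all their components
  together control the displacement in a chart at each point of \<open>L\<close>. A common scaling
  makes the sum small on \<open>K\<close> and only shrinks \<open>\<delta>\<close>.\<close>

lemma immersive_functions_exist:
  fixes B :: "('a, 'n::finite) chart set"
  assumes M: "complex_manifold Y B" and coord: "has_global_coordinates Y B"
    and L: "compactin Y L" and K: "compactin Y K"
  shows "\<exists>J. finite J \<and> J \<subseteq> holomorphic_functions B \<and> (\<forall>y\<in>K. (\<Sum>g\<in>J. (norm (g y))\<^sup>2) < 1 / 2) \<and>
    (\<forall>p\<in>L. \<exists>U F \<delta>. chart_of Y (U, F :: 'a \<Rightarrow> complex ^ 'n) \<and> p \<in> U \<and> (\<forall>c\<in>B. compatible_charts (U, F) c) \<and> \<delta> > 0 \<and>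
      (\<forall>x\<in>U. \<delta> * (norm (F x - F p))\<^sup>2 \<le> (\<Sum>g\<in>J. (norm (g x - g p))\<^sup>2)))"
proof -
  define Ch where "Ch = {(U, F :: 'a \<Rightarrow> complex ^ 'n). chart_of Y (U, F) \<and>
    (\<forall>i. (\<lambda>x. F x $ i) \<in> holomorphic_functions B) \<and> (\<forall>c\<in>B. compatible_charts (U, F) c)}"
  have "L \<subseteq> \<Union> (fst ` Ch)"
  proof
    fix p assume "p \<in> L"
    then have "p \<in> topspace Y" using L compactin_subset_topspace by blast
    then obtain F :: "'a \<Rightarrow> complex ^ 'n" and U where "\<forall>i. (\<lambda>x. F x $ i) \<in> holomorphic_functions B"
      "p \<in> U" "chart_of Y (U, F)" "\<forall>c\<in>B. compatible_charts (U, F) c"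
      using coord unfolding has_global_coordinates_def by blast
    then have "(U, F) \<in> Ch" "p \<in> fst (U, F)" by (auto simp: Ch_def)
    then show "p \<in> \<Union> (fst ` Ch)" by blast
  qed
  moreover have "openin Y U" if U: "U \<in> fst ` Ch" for U
  proof -
    obtain F where "(U, F) \<in> Ch" using U by force
    then show ?thesis using chart_ofD(1)[of Y U F] by (simp add: Ch_def)
  qed
  ultimately obtain \<U> where "finite \<U>" "\<U> \<subseteq> fst ` Ch" "L \<subseteq> \<Union> \<U>"
    using compactinD[OF L, of "fst ` Ch"] by blast
  then obtain Ch0 where Ch0: "finite Ch0" "Ch0 \<subseteq> Ch" "L \<subseteq> \<Union> (fst ` Ch0)"
    by (metis finite_subset_image)
  define J0 where "J0 = (\<lambda>(c, i) x. snd c x $ i) ` (Ch0 \<times> (UNIV :: 'n set))"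
  have J0: "finite J0" "J0 \<subseteq> holomorphic_functions B"
  proof -
    show "finite J0" unfolding J0_def using Ch0(1) by simp
    show "J0 \<subseteq> holomorphic_functions B"
    proof
      fix h assume "h \<in> J0"
      then obtain c i where "c \<in> Ch0" "h = (\<lambda>x. snd c x $ i)" unfolding J0_def by force
      then show "h \<in> holomorphic_functions B" using Ch0(2) unfolding Ch_def by (cases c) auto
    qed
  qed
  have "compactin euclideanreal ((\<lambda>x. \<Sum>g\<in>J0. (norm (g x))\<^sup>2) ` K)"
    by (rule image_compactin[OF K continuous_map_sum_norm_square[OF M J0]])
  then have "bounded ((\<lambda>x. \<Sum>g\<in>J0. (norm (g x))\<^sup>2) ` K)" by (simp add: compact_imp_bounded)
  then obtain b where "b > 0" and "\<forall>v\<in>(\<lambda>x. \<Sum>g\<in>J0. (norm (g x))\<^sup>2) ` K. norm v \<le> b"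
    unfolding bounded_pos by blast
  then have b: "(\<Sum>g\<in>J0. (norm (g y))\<^sup>2) \<le> b" if "y \<in> K" for y
  proof -
    have "norm (\<Sum>g\<in>J0. (norm (g y))\<^sup>2) \<le> b"
      using \<open>\<forall>v\<in>_ ` K. norm v \<le> b\<close> that by blast
    then show ?thesis by simp
  qed
  \<comment> \<open>Chosen so that \<open>\<epsilon>\<^sup>2 * b < 1 / 2\<close>.\<close>
  define \<epsilon> where "\<epsilon> = sqrt (1 / (2 * (b + 1)))"
  have "\<epsilon> > 0" and \<epsilon>2: "\<epsilon>\<^sup>2 = 1 / (2 * (b + 1))" using \<open>b > 0\<close> by (auto simp: \<epsilon>_def)
  define J where "J = (\<lambda>g x. of_real \<epsilon> * g x) ` J0"
  have "finite J" using J0 by (simp add: J_def)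
  moreover have "J \<subseteq> holomorphic_functions B"
  proof
    fix h assume "h \<in> J"
    then obtain g where "g \<in> J0" "h = (\<lambda>x. of_real \<epsilon> * g x)" unfolding J_def by blast
    then show "h \<in> holomorphic_functions B"
      using J0(2) holomorphic_functions_mult[OF holomorphic_functions_const] by blast
  qed
  moreover have "(\<Sum>g\<in>J. (norm (g y))\<^sup>2) < 1 / 2" if "y \<in> K" for y
  proof -
    have "(\<Sum>g\<in>J. (norm (g y))\<^sup>2) \<le> (\<Sum>g\<in>J0. (norm (of_real \<epsilon> * g y))\<^sup>2)"
      unfolding J_def using sum_image_le[OF J0(1), of "\<lambda>g. (norm (g y))\<^sup>2" "\<lambda>g x. of_real \<epsilon> * g x"] by (simp add: o_def)
    also have "\<dots> = \<epsilon>\<^sup>2 * (\<Sum>g\<in>J0. (norm (g y))\<^sup>2)"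
      by (simp add: norm_mult power_mult_distrib sum_distrib_left)
    also have "\<dots> \<le> \<epsilon>\<^sup>2 * b" using b[OF that] by (intro mult_left_mono) auto
    also have "\<dots> < 1 / 2" using \<open>b > 0\<close> by (simp add: \<epsilon>2 divide_less_eq)
    finally show ?thesis .
  qed
  moreover have "\<exists>U F \<delta>. chart_of Y (U, F :: 'a \<Rightarrow> complex ^ 'n) \<and> p \<in> U \<and> (\<forall>c\<in>B. compatible_charts (U, F) c) \<and> \<delta> > 0 \<and>
      (\<forall>x\<in>U. \<delta> * (norm (F x - F p))\<^sup>2 \<le> (\<Sum>g\<in>J. (norm (g x - g p))\<^sup>2))" if p: "p \<in> L" for p
  proof -
    obtain c0 where "c0 \<in> Ch0" "p \<in> fst c0" using Ch0(3) p by blast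
    then obtain U F where c: "(U, F) \<in> Ch0" "p \<in> U" by (cases c0) auto
    \<comment> \<open>Each component of \<open>F\<close> is bounded by the whole sum over
      \<open>J\<close>. Adding these bounds costs the factor \<open>CARD('n)\<close> and avoids
      comparing the components as elements of a set.\<close>
    define \<delta> where "\<delta> = \<epsilon>\<^sup>2 / real CARD('n)"
    have "\<delta> > 0" using \<open>\<epsilon> > 0\<close> by (simp add: \<delta>_def)
    moreover have "\<delta> * (norm (F x - F p))\<^sup>2 \<le> (\<Sum>g\<in>J. (norm (g x - g p))\<^sup>2)" for x
    proof -
      have comp: "\<epsilon>\<^sup>2 * (norm ((F x - F p) $ i))\<^sup>2 \<le> (\<Sum>g\<in>J. (norm (g x - g p))\<^sup>2)" for i
      proof -
        define h where "h x = of_real \<epsilon> * F x $ i" for x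
        have "(\<lambda>x. F x $ i) \<in> J0"
          unfolding J0_def by (rule image_eqI[of _ _ "((U, F), i)"]) (simp_all add: c(1))
        then have "h \<in> J"
          unfolding J_def h_def[abs_def] by (rule imageI)
        then have "(norm (h x - h p))\<^sup>2 \<le> (\<Sum>g\<in>J. (norm (g x - g p))\<^sup>2)"
          by (rule member_le_sum) (simp_all add: \<open>finite J\<close>)
        moreover have "h x - h p = of_real \<epsilon> * (F x - F p) $ i"
          by (simp add: h_def right_diff_distrib)
        ultimately show ?thesis by (simp add: norm_mult power_mult_distrib)
      qed
      have "\<epsilon>\<^sup>2 * (norm (F x - F p))\<^sup>2 = (\<Sum>i\<in>(UNIV :: 'n set). \<epsilon>\<^sup>2 * (norm ((F x - F p) $ i))\<^sup>2)"
        unfolding norm_vec_square by (rule sum_distrib_left)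
      also have "\<dots> \<le> (\<Sum>i\<in>(UNIV :: 'n set). (\<Sum>g\<in>J. (norm (g x - g p))\<^sup>2))"
        by (rule sum_mono) (rule comp)
      also have "\<dots> = real CARD('n) * (\<Sum>g\<in>J. (norm (g x - g p))\<^sup>2)"
        by (rule sum_constant)
      finally show ?thesis
        unfolding \<delta>_def times_divide_eq_left by (subst pos_divide_le_eq) (simp_all add: mult.commute)
    qed
    moreover have "chart_of Y (U, F)" "\<forall>c\<in>B. compatible_charts (U, F) c"
      using subsetD[OF Ch0(2) c(1)] unfolding Ch_def by simp_all
    ultimately show ?thesis using c(2) by (intro exI[of _ U] exI[of _ F] exI[of _ \<delta>]) simp
  qed
  ultimately show ?thesis by (intro exI[of _ J] conjI ballI) blast+
qed

section \<open>Connectedness at infinity\<close>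

text \<open>The topological half of the argument: at the critical level \<open>c0\<close> the points
  are separated, and \<open>clos\<close> and \<open>local\<close> allow this separation to be
  extended across the level set to slightly smaller levels, where the points are still
  joined.\<close>

lemma superlevel_joined:
  fixes \<phi> :: "'a \<Rightarrow> real"
  assumes H: "Hausdorff_space Y" and lpc: "locally_path_connected_space Y" and conn: "connected_space Y"
    and L: "compactin Y L" and cont: "continuous_map Y euclideanreal \<phi>" and nonneg: "\<And>x. \<phi> x \<ge> 0"
    and bdry: "\<And>x. x \<in> L \<Longrightarrow> x \<notin> Y interior_of L \<Longrightarrow> \<phi> x > 1"
    and clos: "\<And>p. p \<in> Y interior_of L \<Longrightarrow> p \<in> Y closure_of {x \<in> Y interior_of L. \<phi> x > \<phi> p}"
    and local: "\<And>p. p \<in> Y interior_of L \<Longrightarrow> \<exists>N C. openin Y N \<and> p \<in> N \<and> N \<subseteq> Y interior_of L \<and> connectedin Y C \<and>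
      C \<subseteq> {x \<in> Y interior_of L. \<phi> x > \<phi> p} \<and> N \<inter> {x \<in> Y interior_of L. \<phi> x > \<phi> p} \<subseteq> C"
    and a: "a \<in> topspace Y" "a \<notin> L" and b: "b \<in> topspace Y" "b \<notin> L"
  shows "\<exists>T. connectedin Y T \<and> a \<in> T \<and> b \<in> T \<and> T \<inter> {x \<in> L. \<phi> x \<le> 1} = {}"
proof (rule ccontr)
  \<comment> \<open>Only points of \<open>L\<close> are removed, so \<open>a\<close> and
    \<open>b\<close> remain in \<open>E c\<close> at every level.\<close>
  define E where "E c = topspace Y - {x \<in> L. \<phi> x \<le> c}" for c
  define joined where "joined c \<longleftrightarrow> (\<exists>T. connectedin Y T \<and> a \<in> T \<and> b \<in> T \<and> T \<subseteq> E c)" for c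
  assume "\<nexists>T. connectedin Y T \<and> a \<in> T \<and> b \<in> T \<and> T \<inter> {x \<in> L. \<phi> x \<le> 1} = {}"
  then have not1: "\<not> joined 1"
    unfolding joined_def E_def by blast
  have L_closed: "closedin Y L" by (rule compactin_imp_closedin[OF H L])
  have L_top: "L \<subseteq> topspace Y" by (rule compactin_subset_topspace[OF L])
  have attains: "(\<exists>m. (\<exists>x\<in>K. \<phi> x = m) \<and> (\<forall>x\<in>K. \<phi> x \<le> m)) \<and> (\<exists>m. (\<exists>x\<in>K. \<phi> x = m) \<and> (\<forall>x\<in>K. m \<le> \<phi> x))"
    if K: "compactin Y K" "K \<noteq> {}" for K
  proof -
    have "compact (\<phi> ` K)" using image_compactin[OF K(1) cont] by simp
    then show ?thesis
      using compact_attains_sup[of "\<phi> ` K"] compact_attains_inf[of "\<phi> ` K"] K(2) by blast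
  qed
  have closed_le: "closedin Y {x \<in> L. \<phi> x \<le> c}" for c
  proof -
    have "closedin Y {x \<in> topspace Y. \<phi> x \<in> {..c}}"
      by (rule closedin_continuous_map_preimage[OF cont]) simp
    then have "closedin Y (L \<inter> {x \<in> topspace Y. \<phi> x \<in> {..c}})"
      by (rule closedin_Int[OF L_closed])
    moreover have "L \<inter> {x \<in> topspace Y. \<phi> x \<in> {..c}} = {x \<in> L. \<phi> x \<le> c}"
      using L_top by auto
    ultimately show ?thesis by simp
  qed
  have E_open: "openin Y (E c)" for c
    unfolding E_def by (rule openin_diff[OF openin_topspace closed_le])
  have aE: "a \<in> E c" and bE: "b \<in> E c" for c using a b by (simp_all add: E_def)
  have mono: "joined c" if "joined c'" "c \<le> c'" for c c'
  proof -
    have "E c' \<subseteq> E c" using \<open>c \<le> c'\<close> by (auto simp: E_def)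
    then show ?thesis using \<open>joined c'\<close> unfolding joined_def by blast
  qed
  have joined_neg: "joined c" if c: "c < 0" for c
  proof -
    have "{x \<in> L. \<phi> x \<le> c} = {}" using nonneg c by (auto simp: not_le intro: less_le_trans)
    then have "E c = topspace Y" unfolding E_def by blast
    moreover have "connectedin Y (topspace Y)" using conn by (simp add: connectedin_topspace)
    ultimately show ?thesis unfolding joined_def using a b by blast
  qed
  define S where "S = {c. \<not> joined c}"
  have "1 \<in> S" using not1 by (simp add: S_def)
  have S_bdd: "bdd_below S"
  proof (rule bdd_belowI)
    show "0 \<le> c" if "c \<in> S" for c
      using that joined_neg[of c] unfolding S_def by force
  qed
  define c0 where "c0 = Inf S"
  have "c0 \<le> 1" unfolding c0_def by (rule cInf_lower[OF \<open>1 \<in> S\<close> S_bdd])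
  have above: "\<not> joined c" if c: "c > c0" for c
  proof -
    have "\<exists>c'\<in>S. c' < c"
      using cInf_lessD[of S c] \<open>1 \<in> S\<close> c unfolding c0_def by blast
    then obtain c' where "\<not> joined c'" "c' < c" unfolding S_def by blast
    then show ?thesis using mono[of c c'] less_imp_le by blast
  qed
  have below: "joined c" if "c < c0" for c
  proof (rule ccontr)
    assume "\<not> joined c"
    then have "c0 \<le> c" unfolding c0_def by (intro cInf_lower[OF _ S_bdd]) (simp add: S_def)
    then show False using that by simp
  qed

  \<comment> \<open>A joining set in \<open>E c0\<close> can be replaced by a path. On the compact
    part of the path in \<open>L\<close> the minimum of \<open>\<phi>\<close> exceeds
    \<open>c0\<close>, so the points would be joined at a level above \<open>c0\<close> too.\<close>
  have not_c0: "\<not> joined c0"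
  proof
    assume "joined c0"
    then have "connected_component_of (subtopology Y (E c0)) a b"
      unfolding joined_def connected_component_of_def connectedin_subtopology by blast
    moreover have "locally_path_connected_space (subtopology Y (E c0))"
      by (rule locally_path_connected_space_open_subset[OF lpc E_open])
    ultimately have "path_component_of (subtopology Y (E c0)) a b"
      using path_component_eq_connected_component_of[of "subtopology Y (E c0)" a] by blast
    then obtain g where g: "pathin (subtopology Y (E c0)) g" "g 0 = a" "g 1 = b"
      unfolding path_component_of_def by blast
    define P where "P = g ` {0..1}"
    have gY: "pathin Y g" and PE: "P \<subseteq> E c0"
      using g(1) unfolding pathin_subtopology P_def by blast+
    have "compactin Y P" "connectedin Y P"
      unfolding P_def by (rule compactin_path_image[OF gY], rule connectedin_path_image[OF gY])
    have ab: "a \<in> P" "b \<in> P" using g(2,3) unfolding P_def by force+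
    have "compactin Y (P \<inter> L)" by (rule compact_Int_closedin[OF \<open>compactin Y P\<close> L_closed])
    have "\<exists>c>c0. \<forall>x\<in>P \<inter> L. \<phi> x > c"
    proof (cases "P \<inter> L = {}")
      case True
      then show ?thesis by (intro exI[of _ "c0 + 1"]) simp
    next
      case False
      obtain x where x: "x \<in> P \<inter> L" "\<forall>y\<in>P \<inter> L. \<phi> x \<le> \<phi> y"
        using attains[OF \<open>compactin Y (P \<inter> L)\<close> False] by blast
      have "\<phi> x > c0" using x(1) PE by (auto simp: E_def)
      show ?thesis
      proof (intro exI[of _ "(\<phi> x + c0) / 2"] conjI ballI)
        show "(\<phi> x + c0) / 2 > c0" using \<open>\<phi> x > c0\<close> by simp
        show "(\<phi> x + c0) / 2 < \<phi> y" if "y \<in> P \<inter> L" for y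
        proof -
          have "\<phi> x \<le> \<phi> y" using x(2) that by blast
          then show ?thesis using \<open>\<phi> x > c0\<close> by simp
        qed
      qed
    qed
    then obtain c where c: "c > c0" "\<forall>x\<in>P \<inter> L. \<phi> x > c" by blast
    have "P \<subseteq> E c" using c(2) PE by (force simp: E_def)
    then have "joined c" unfolding joined_def using ab \<open>connectedin Y P\<close> by blast
    then show False using above[OF c(1)] by blast
  qed

  \<comment> \<open>\<open>U\<close> and \<open>V\<close> separate \<open>a\<close> from
    \<open>b\<close> in \<open>E c0\<close>: the component \<open>U\<close> is open by local
    connectedness and closed relative to \<open>E c0\<close>, so \<open>V\<close> is open as
    well.\<close>
  define U where "U = connected_component_of_set (subtopology Y (E c0)) a"
  define V where "V = E c0 - U"
  have lc: "locally_connected_space (subtopology Y (E c0))"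
    by (rule locally_path_connected_imp_locally_connected_space[OF
          locally_path_connected_space_open_subset[OF lpc E_open]])
  have top_E: "topspace (subtopology Y (E c0)) = E c0"
    using openin_subset[OF E_open[of c0]] by auto
  have "U \<subseteq> E c0" unfolding U_def using connected_component_of_subset_topspace[of "subtopology Y (E c0)" a]
    unfolding top_E .
  have "openin Y U"
    unfolding U_def
    by (rule openin_trans_full[OF openin_connected_component_of_locally_connected_space[OF lc] E_open])
  have "openin (subtopology Y (E c0)) (topspace (subtopology Y (E c0)) - U)"
    unfolding U_def by (rule openin_diff[OF openin_topspace closedin_connected_component_of])
  then have "openin Y V"
    unfolding V_def top_E by (rule openin_trans_full[OF _ E_open])
  have "a \<in> U"
    using aE[of c0] a(1) by (simp add: U_def connected_component_of_refl)
  have "b \<notin> U"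
  proof
    assume "b \<in> U"
    then have "joined c0"
      unfolding U_def joined_def connected_component_of_def connectedin_subtopology by blast
    then show False using not_c0 by blast
  qed
  then have "b \<in> V" using bE by (simp add: V_def)
  have in_U: "C \<subseteq> U \<or> C \<inter> U = {}" if C: "connectedin Y C" "C \<subseteq> E c0" for C
  proof (cases "C \<inter> U = {}")
    case False
    then obtain x where x: "x \<in> C" "x \<in> U" by blast
    have "connectedin (subtopology Y (E c0)) C" using C by (simp add: connectedin_subtopology)
    then have "C \<subseteq> connected_component_of_set (subtopology Y (E c0)) x"
      by (rule connected_component_of_maximal[OF _ x(1)])
    moreover have "connected_component_of_set (subtopology Y (E c0)) x = U"
      using x(2) unfolding U_def by (metis connected_component_of_equiv mem_Collect_eq)
    ultimately show ?thesis by blast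
  qed blast
  define D where "D = {x \<in> L. \<phi> x = c0}"
  have D_comp: "compactin Y D"
  proof -
    have "closedin Y {x \<in> topspace Y. \<phi> x \<in> {c0}}"
      by (rule closedin_continuous_map_preimage[OF cont]) simp
    then have "compactin Y (L \<inter> {x \<in> topspace Y. \<phi> x \<in> {c0}})"
      by (rule compact_Int_closedin[OF L])
    moreover have "L \<inter> {x \<in> topspace Y. \<phi> x \<in> {c0}} = D"
      using L_top by (auto simp: D_def)
    ultimately show ?thesis by simp
  qed
  \<comment> \<open>Every point of the level set adheres to exactly one side: to at least one by
    \<open>clos\<close>, to at most one because near \<open>p\<close> the set \<open>E c0\<close> is
    contained in one connected piece. The bound \<open>c0 \<le> 1\<close> keeps \<open>p\<close> off
    the boundary of \<open>L\<close>.\<close>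
  have D: "(p \<in> Y closure_of U \<or> p \<in> Y closure_of V) \<and> \<not> (p \<in> Y closure_of U \<and> p \<in> Y closure_of V)"
    if p: "p \<in> D" for p
  proof
    have pint: "p \<in> Y interior_of L" and \<phi>p: "\<phi> p = c0"
      using p bdry[of p] \<open>c0 \<le> 1\<close> by (auto simp: D_def)
    define E' where "E' = {x \<in> Y interior_of L. \<phi> x > \<phi> p}"
    have E': "E' = Y interior_of L \<inter> E c0"
      using interior_of_subset[of Y L] L_top by (auto simp: E'_def E_def \<phi>p not_le)
    have "U \<union> V = E c0" using \<open>U \<subseteq> E c0\<close> by (auto simp: V_def)
    then have "E' \<subseteq> U \<union> V" using E' by blast
    then have "Y closure_of E' \<subseteq> Y closure_of U \<union> Y closure_of V"
      using closure_of_mono closure_of_Un by metis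
    then show "p \<in> Y closure_of U \<or> p \<in> Y closure_of V"
      using clos[OF pint, folded E'_def] by blast
    obtain N C where N: "openin Y N" "p \<in> N" "N \<subseteq> Y interior_of L"
      and C: "connectedin Y C" "C \<subseteq> E'" "N \<inter> E' \<subseteq> C"
      using local[OF pint, folded E'_def] by blast
    have "C \<subseteq> E c0" using C(2) E' by blast
    have NE: "N \<inter> E c0 \<subseteq> C" using C(3) N(3) E' by blast
    have "N \<inter> U = {} \<or> N \<inter> V = {}"
      using in_U[OF C(1) \<open>C \<subseteq> E c0\<close>] NE \<open>U \<subseteq> E c0\<close> unfolding V_def by blast
    then show "\<not> (p \<in> Y closure_of U \<and> p \<in> Y closure_of V)"
      unfolding in_closure_of using N(1,2) by blast
  qed
  have "compactin Y (D \<inter> Y closure_of U)" "compactin Y (D \<inter> Y closure_of V)"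
    by (rule compact_Int_closedin[OF D_comp closedin_closure_of])+
  moreover have "disjnt (D \<inter> Y closure_of U) (D \<inter> Y closure_of V)"
    unfolding disjnt_def using D by blast
  ultimately obtain O1 O2 where O: "openin Y O1" "openin Y O2" "D \<inter> Y closure_of U \<subseteq> O1"
    "D \<inter> Y closure_of V \<subseteq> O2" "disjnt O1 O2"
    by (rule Hausdorff_space_compact_separation[OF H])
  \<comment> \<open>Each side absorbs the part of the level set adhering to it. Removing the closure
    of the other side keeps the enlarged open sets disjoint.\<close>
  define U' where "U' = U \<union> (O1 - Y closure_of V)"
  define V' where "V' = V \<union> (O2 - Y closure_of U)"
  have "openin Y U'" "openin Y V'"
    unfolding U'_def V'_def
    using \<open>openin Y U\<close> \<open>openin Y V\<close> O(1,2) by (blast intro: openin_Un openin_diff closedin_closure_of)+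
  have "U \<subseteq> Y closure_of U" "V \<subseteq> Y closure_of V"
    by (rule closure_of_subset[OF openin_subset], fact)+
  then have disj: "U' \<inter> V' = {}"
    using O(5) unfolding U'_def V'_def disjnt_def V_def by blast
  have "D \<subseteq> U' \<union> V'" using D O(3,4) unfolding U'_def V'_def by blast
  have "E c0 \<subseteq> U' \<union> V'" unfolding U'_def V'_def V_def by blast
  \<comment> \<open>The points not yet covered form a compact set with \<open>\<phi> < c0\<close>,
    so their maximum leaves a gap below \<open>c0\<close>, and \<open>U'\<close>, \<open>V'\<close>
    cover some \<open>E c\<close> with \<open>c < c0\<close>.\<close>
  define R where "R = L - (U' \<union> V')"
  have R_comp: "compactin Y R"
    unfolding R_def
    by (rule closed_compactin[OF L _ closedin_diff[OF L_closed openin_Un]]) (blast, fact+)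
  have R: "\<phi> x < c0" if x: "x \<in> R" for x
  proof -
    have "x \<notin> E c0" "x \<notin> D" "x \<in> L"
      using x \<open>D \<subseteq> U' \<union> V'\<close> \<open>E c0 \<subseteq> U' \<union> V'\<close> unfolding R_def by blast+
    then show ?thesis using L_top unfolding E_def D_def by force
  qed
  have "\<exists>c<c0. \<forall>x\<in>R. \<phi> x \<le> c"
  proof (cases "R = {}")
    case True
    then show ?thesis by (intro exI[of _ "c0 - 1"]) simp
  next
    case False
    obtain x where "x \<in> R" "\<forall>y\<in>R. \<phi> y \<le> \<phi> x"
      using attains[OF R_comp False] by blast
    then show ?thesis using R by blast
  qed
  then obtain c where c: "c < c0" "\<forall>x\<in>R. \<phi> x \<le> c" by blast
  have "E c \<subseteq> U' \<union> V'"
  proof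
    fix x assume x: "x \<in> E c"
    show "x \<in> U' \<union> V'"
    proof (cases "x \<in> L")
      case True
      then have "x \<notin> R" using x c(2) unfolding E_def by blast
      then show ?thesis using True unfolding R_def by blast
    next
      case False
      then have "x \<in> E c0" using x unfolding E_def by blast
      then show ?thesis using \<open>E c0 \<subseteq> U' \<union> V'\<close> by blast
    qed
  qed
  obtain T where T: "connectedin Y T" "a \<in> T" "b \<in> T" "T \<subseteq> E c"
    using below[OF c(1)] unfolding joined_def by blast
  have "T \<subseteq> U' \<union> V'" using T(4) \<open>E c \<subseteq> U' \<union> V'\<close> by blast
  moreover have "U' \<inter> V' \<inter> T = {}" using disj by blast
  moreover have "U' \<inter> T \<noteq> {}" "V' \<inter> T \<noteq> {}"
    using T(2,3) \<open>a \<in> U\<close> \<open>b \<in> V\<close> unfolding U'_def V'_def by blast+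
  ultimately show False
    using T(1) \<open>openin Y U'\<close> \<open>openin Y V'\<close> unfolding connectedin by blast
qed

section \<open>Stein manifolds of dimension greater than one have one end\<close>

text \<open>Holomorphic convexity makes the hull of \<open>K\<close> compact, hence contained in the
  interior of a compact \<open>L\<close>. Peak functions take care of the boundary of
  \<open>L\<close>, immersive functions of the local estimate, and each family contributes less than
  \<open>1 / 2\<close> on \<open>K\<close>.\<close>

lemma exhausting_functions_exist:
  fixes B :: "('a, 'n::finite) chart set"
  assumes stein: "stein_manifold Y B" and K: "compactin Y K" "K \<noteq> {}"
  shows "\<exists>L I. compactin Y L \<and> K \<subseteq> L \<and> finite I \<and> I \<subseteq> holomorphic_functions B \<and>
    (\<forall>x\<in>K. (\<Sum>f\<in>I. (norm (f x))\<^sup>2) \<le> 1) \<and>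
    (\<forall>x\<in>L - Y interior_of L. (\<Sum>f\<in>I. (norm (f x))\<^sup>2) > 1) \<and>
    (\<forall>p\<in>L. \<exists>U F \<delta>. chart_of Y (U, F :: 'a \<Rightarrow> complex ^ 'n) \<and> p \<in> U \<and> (\<forall>c\<in>B. compatible_charts (U, F) c) \<and>
      \<delta> > 0 \<and> (\<forall>x\<in>U. \<delta> * (norm (F x - F p))\<^sup>2 \<le> (\<Sum>f\<in>I. (norm (f x - f p))\<^sup>2)))"
proof -
  have M: "complex_manifold Y B" and coord: "has_global_coordinates Y B"
    and hull: "compactin Y (holomorphic_hull Y B K)"
    using stein K(1) unfolding stein_manifold_def holomorphically_convex_def by blast+
  note H = complex_manifoldD(1)[OF M]
  obtain Z L where Z: "openin Y Z" "holomorphic_hull Y B K \<subseteq> Z" "Z \<subseteq> L" and L: "compactin Y L" "closedin Y L"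
    using locally_compact_space_manifold[OF M] hull
    unfolding locally_compact_space_compact_closed_compact[OF disjI1[OF H]] by blast
  have K_hull: "K \<subseteq> holomorphic_hull Y B K"
    using compactin_subset_topspace[OF K(1)] unfolding holomorphic_hull_def by blast
  define D where "D = L - Y interior_of L"
  have D: "compactin Y D"
    unfolding D_def by (rule closed_compactin[OF L(1) _ closedin_diff[OF L(2) openin_interior_of]]) blast
  have D_hull: "D \<inter> holomorphic_hull Y B K = {}"
    using interior_of_maximal[OF Z(3,1)] Z(2) unfolding D_def by blast
  obtain G where G: "finite G" "G \<subseteq> holomorphic_functions B" "\<forall>y\<in>K. (\<Sum>g\<in>G. (norm (g y))\<^sup>2) < 1 / 2"
    "\<forall>x\<in>D. (\<Sum>g\<in>G. (norm (g x))\<^sup>2) > 1"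
    using peak_functions_exist[OF M K(2) D D_hull] by blast
  obtain J where J: "finite J" "J \<subseteq> holomorphic_functions B" "\<forall>y\<in>K. (\<Sum>g\<in>J. (norm (g y))\<^sup>2) < 1 / 2"
    "\<forall>p\<in>L. \<exists>U F \<delta>. chart_of Y (U, F :: 'a \<Rightarrow> complex ^ 'n) \<and> p \<in> U \<and> (\<forall>c\<in>B. compatible_charts (U, F) c) \<and> \<delta> > 0 \<and>
      (\<forall>x\<in>U. \<delta> * (norm (F x - F p))\<^sup>2 \<le> (\<Sum>g\<in>J. (norm (g x - g p))\<^sup>2))"
    using immersive_functions_exist[OF M coord L(1) K(1)] by blast
  define I where "I = G \<union> J"
  have I: "finite I" "I \<subseteq> holomorphic_functions B" using G(1,2) J(1,2) by (simp_all add: I_def)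
  \<comment> \<open>The two families may overlap, so the sum over the union is only
    estimated.\<close>
  have le: "sum h G \<le> sum h I" "sum h J \<le> sum h I" "sum h I \<le> sum h G + sum h J"
    if "\<And>g. h g \<ge> 0" for h :: "('a \<Rightarrow> complex) \<Rightarrow> real"
  proof -
    show "sum h G \<le> sum h I" "sum h J \<le> sum h I"
      using that I(1) by (auto intro!: sum_mono2 simp: I_def)
    have "sum h I + sum h (G \<inter> J) = sum h G + sum h J"
      unfolding I_def by (rule sum.union_inter[OF G(1) J(1)])
    moreover have "sum h (G \<inter> J) \<ge> 0" using that by (rule sum_nonneg)
    ultimately show "sum h I \<le> sum h G + sum h J" by linarith
  qed
  have small: "(\<Sum>f\<in>I. (norm (f x))\<^sup>2) \<le> 1" if "x \<in> K" for x
    using le(3)[of "\<lambda>f. (norm (f x))\<^sup>2"] G(3)[rule_format, OF that] J(3)[rule_format, OF that] by simp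
  have large: "(\<Sum>f\<in>I. (norm (f x))\<^sup>2) > 1" if "x \<in> L - Y interior_of L" for x
    using le(1)[of "\<lambda>f. (norm (f x))\<^sup>2"] G(4)[rule_format, of x] that by (simp add: D_def)
  have coords: "\<exists>U F \<delta>. chart_of Y (U, F :: 'a \<Rightarrow> complex ^ 'n) \<and> p \<in> U \<and> (\<forall>c\<in>B. compatible_charts (U, F) c) \<and> \<delta> > 0 \<and>
      (\<forall>x\<in>U. \<delta> * (norm (F x - F p))\<^sup>2 \<le> (\<Sum>f\<in>I. (norm (f x - f p))\<^sup>2))" if p: "p \<in> L" for p
  proof -
    obtain U and F :: "'a \<Rightarrow> complex ^ 'n" and \<delta> where U: "chart_of Y (U, F)" "p \<in> U"
      "\<forall>c\<in>B. compatible_charts (U, F) c" "\<delta> > 0"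
      and lower: "\<forall>x\<in>U. \<delta> * (norm (F x - F p))\<^sup>2 \<le> (\<Sum>g\<in>J. (norm (g x - g p))\<^sup>2)"
      using J(4) p by blast
    have "\<delta> * (norm (F x - F p))\<^sup>2 \<le> (\<Sum>f\<in>I. (norm (f x - f p))\<^sup>2)" if "x \<in> U" for x
      using lower[rule_format, OF that] le(2)[of "\<lambda>f. (norm (f x - f p))\<^sup>2"] by simp
    then show ?thesis using U by (intro exI[of _ U] exI[of _ F] exI[of _ \<delta>]) simp
  qed
  show ?thesis
  proof (rule exI[of _ L], rule exI[of _ I], intro conjI ballI)
    show "compactin Y L" by (rule L(1))
    show "K \<subseteq> L" using K_hull Z(2,3) by blast
    show "finite I" "I \<subseteq> holomorphic_functions B" by (rule I)+
  qed (rule small large coords; assumption)+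
qed

text \<open>If neither \<open>U\<close> nor \<open>V\<close> is contained in a compact set, each has
  a point outside \<open>L\<close>. \<open>superlevel_joined\<close> connects these points by a set
  avoiding \<open>K\<close>, which \<open>U\<close> and \<open>V\<close> would disconnect.\<close>

lemma stein_one_end:
  fixes B :: "('a, 'n::finite) chart set"
  assumes n: "CARD('n) > 1" and stein: "stein_manifold Y B" and conn: "connected_space Y"
    and K: "compactin Y K" and UV: "openin Y U" "openin Y V" "U \<inter> V = {}" "topspace Y - K \<subseteq> U \<union> V"
  shows "\<exists>L. compactin Y L \<and> (U \<subseteq> L \<or> V \<subseteq> L)"
proof (cases "topspace Y = {}")
  case True
  then show ?thesis using openin_subset[OF UV(1)] by (intro exI[of _ "{}"]) simp
next
  case False
  then obtain y where y: "y \<in> topspace Y" by blast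
  \<comment> \<open>A point is added because the construction of the exhausting functions takes a
    nonempty compact set.\<close>
  define K' where "K' = insert y K"
  have "compactin Y ({y} \<union> K)" by (rule compactin_Un[OF _ K]) (simp add: y)
  then have K': "compactin Y K'" "K' \<noteq> {}" by (simp_all add: K'_def)
  have M: "complex_manifold Y B" using stein unfolding stein_manifold_def by blast
  obtain L I where L: "compactin Y L" "K' \<subseteq> L" and I: "finite I" "I \<subseteq> holomorphic_functions B"
    and small: "\<forall>x\<in>K'. (\<Sum>f\<in>I. (norm (f x))\<^sup>2) \<le> 1"
    and large: "\<forall>x\<in>L - Y interior_of L. (\<Sum>f\<in>I. (norm (f x))\<^sup>2) > 1"
    and coords: "\<forall>p\<in>L. \<exists>U F \<delta>. chart_of Y (U, F :: 'a \<Rightarrow> complex ^ 'n) \<and> p \<in> U \<and> (\<forall>c\<in>B. compatible_charts (U, F) c) \<and>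
      \<delta> > 0 \<and> (\<forall>x\<in>U. \<delta> * (norm (F x - F p))\<^sup>2 \<le> (\<Sum>f\<in>I. (norm (f x - f p))\<^sup>2))"
    using exhausting_functions_exist[OF stein K'] by blast
  define \<phi> where "\<phi> x = (\<Sum>f\<in>I. (norm (f x))\<^sup>2)" for x
  show ?thesis
  proof (rule ccontr)
    assume "\<nexists>L. compactin Y L \<and> (U \<subseteq> L \<or> V \<subseteq> L)"
    then obtain a b where a: "a \<in> U" "a \<notin> L" and b: "b \<in> V" "b \<notin> L"
      using L(1) by blast
    have loc: "p \<in> Y closure_of {x \<in> Y interior_of L. \<phi> x > \<phi> p}"
      "\<exists>N C. openin Y N \<and> p \<in> N \<and> N \<subseteq> Y interior_of L \<and> connectedin Y C \<and>
      C \<subseteq> {x \<in> Y interior_of L. \<phi> x > \<phi> p} \<and> N \<inter> {x \<in> Y interior_of L. \<phi> x > \<phi> p} \<subseteq> C"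
      if p: "p \<in> Y interior_of L" for p
    proof -
      have "p \<in> L" using p interior_of_subset[of Y L] by blast
      then obtain U F \<delta> where U: "chart_of Y (U, F :: 'a \<Rightarrow> complex ^ 'n)" "p \<in> U"
        "\<forall>c\<in>B. compatible_charts (U, F) c" "\<delta> > 0"
        "\<forall>x\<in>U. \<delta> * (norm (F x - F p))\<^sup>2 \<le> (\<Sum>f\<in>I. (norm (f x - f p))\<^sup>2)"
        using coords by blast
      note * = superlevel_locally_connected_manifold[OF n M I openin_interior_of p U(1,2)
          U(3)[rule_format] U(4) U(5)[rule_format], folded \<phi>_def]
      show "p \<in> Y closure_of {x \<in> Y interior_of L. \<phi> x > \<phi> p}" by (rule *(1))
      show "\<exists>N C. openin Y N \<and> p \<in> N \<and> N \<subseteq> Y interior_of L \<and> connectedin Y C \<and>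
        C \<subseteq> {x \<in> Y interior_of L. \<phi> x > \<phi> p} \<and> N \<inter> {x \<in> Y interior_of L. \<phi> x > \<phi> p} \<subseteq> C"
        by (rule *(2))
    qed
    have cont: "continuous_map Y euclideanreal \<phi>"
      unfolding \<phi>_def[abs_def] by (rule continuous_map_sum_norm_square[OF M I])
    have "\<phi> x \<ge> 0" for x unfolding \<phi>_def by (simp add: sum_nonneg)
    moreover have "\<phi> x > 1" if "x \<in> L" "x \<notin> Y interior_of L" for x
      unfolding \<phi>_def using large that by blast
    ultimately obtain T where T: "connectedin Y T" "a \<in> T" "b \<in> T" "T \<inter> {x \<in> L. \<phi> x \<le> 1} = {}"
      using superlevel_joined[OF complex_manifoldD(1)[OF M] locally_path_connected_space_manifold[OF M]
          conn L(1) cont _ _ loc _ a(2) _ b(2)] a(1) b(1) openin_subset[OF UV(1)] openin_subset[OF UV(2)]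
      by blast
    have "K' \<subseteq> {x \<in> L. \<phi> x \<le> 1}" using L(2) small unfolding \<phi>_def by blast
    then have "T \<inter> K = {}" using T(4) unfolding K'_def by blast
    moreover have "T \<subseteq> topspace Y" using T(1) unfolding connectedin by blast
    ultimately have "T \<subseteq> U \<union> V" using UV(4) by blast
    moreover have "U \<inter> V \<inter> T = {}" "U \<inter> T \<noteq> {}" "V \<inter> T \<noteq> {}"
      using UV(3) a(1) b(1) T(2,3) by blast+
    ultimately show False using T(1) UV(1,2) unfolding connectedin by blast
  qed
qed

section \<open>From one end to a connected boundary\<close>

theorem corollary3:
  fixes X :: "'a topology" and A :: "('a, 'n::finite) chart set" and \<Omega> :: "'a set"
  assumes "complex_manifold X A"
    and "CARD('n) > 1"
    and "stein_domain_in X A \<Omega>"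
    and "relatively_compact_in X \<Omega>"
  shows "connectedin X (X frontier_of \<Omega>)"
proof (rule ccontr)
  assume disconn: "\<not> connectedin X (X frontier_of \<Omega>)"
  have H: "Hausdorff_space X" by (rule complex_manifoldD(1)[OF assms(1)])
  have \<Omega>: "openin X \<Omega>" "connectedin X \<Omega>" and stein: "stein_manifold (subtopology X \<Omega>) (induced_atlas A \<Omega>)"
    using assms(3) unfolding stein_domain_in_def domain_in_def by blast+
  have cl: "compactin X (X closure_of \<Omega>)"
    using assms(4) unfolding relatively_compact_in_def by blast
  have front: "X frontier_of \<Omega> = X closure_of \<Omega> - \<Omega>"
    unfolding frontier_of_def using interior_of_openin[OF \<Omega>(1)] by simp
  have "X frontier_of \<Omega> \<subseteq> topspace X" by (rule frontier_of_subset_topspace)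
  with disconn obtain E1 E2 where E: "openin X E1" "openin X E2" "X frontier_of \<Omega> \<subseteq> E1 \<union> E2"
    "E1 \<inter> E2 \<inter> X frontier_of \<Omega> = {}" "E1 \<inter> X frontier_of \<Omega> \<noteq> {}" "E2 \<inter> X frontier_of \<Omega> \<noteq> {}"
    unfolding connectedin by blast
  have front_comp: "compactin X (X frontier_of \<Omega> - E)" if "openin X E" for E
    by (rule closed_compactin[OF cl _ closedin_diff[OF closedin_frontier_of that]]) (use front in blast)
  \<comment> \<open>These two sets are the pieces of the disconnected frontier, written as
    differences to show that they are compact.\<close>
  have "disjnt (X frontier_of \<Omega> - E2) (X frontier_of \<Omega> - E1)"
    using E(3) unfolding disjnt_def by blast
  then obtain O1 O2 where O: "openin X O1" "openin X O2" "X frontier_of \<Omega> - E2 \<subseteq> O1"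
    "X frontier_of \<Omega> - E1 \<subseteq> O2" "disjnt O1 O2"
    by (rule Hausdorff_space_compact_separation[OF H front_comp[OF E(2)] front_comp[OF E(1)]])
  \<comment> \<open>The pieces of the frontier are swallowed by \<open>O1\<close> and
    \<open>O2\<close>, so what remains of the compact closure lies inside
    \<open>\<Omega>\<close>.\<close>
  define K where "K = X closure_of \<Omega> - (O1 \<union> O2)"
  have "compactin X K"
    unfolding K_def
    by (rule closed_compactin[OF cl _ closedin_diff[OF closedin_closure_of openin_Un[OF O(1,2)]]]) blast
  moreover have "K \<subseteq> \<Omega>"
    using O(3,4) E(4) front unfolding K_def by blast
  ultimately have K: "compactin (subtopology X \<Omega>) K" unfolding compactin_subtopology by blast
  have top: "topspace (subtopology X \<Omega>) = \<Omega>" using openin_subset[OF \<Omega>(1)] by auto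
  have "\<Omega> \<subseteq> X closure_of \<Omega>" by (rule closure_of_subset[OF openin_subset[OF \<Omega>(1)]])
  then have cover: "topspace (subtopology X \<Omega>) - K \<subseteq> (\<Omega> \<inter> O1) \<union> (\<Omega> \<inter> O2)"
    unfolding top K_def by blast
  have disj: "(\<Omega> \<inter> O1) \<inter> (\<Omega> \<inter> O2) = {}" using O(5) unfolding disjnt_def by blast
  have conn: "connected_space (subtopology X \<Omega>)" using \<Omega>(2) unfolding connectedin_def by blast
  obtain L where L: "compactin (subtopology X \<Omega>) L" "\<Omega> \<inter> O1 \<subseteq> L \<or> \<Omega> \<inter> O2 \<subseteq> L"
    using stein_one_end[OF assms(2) stein conn K openin_subtopology_Int2[OF O(1)]
        openin_subtopology_Int2[OF O(2)] disj cover] by blast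
  have L': "compactin X L" "L \<subseteq> \<Omega>" using L(1) unfolding compactin_subtopology by blast+
  \<comment> \<open>A compact subset of \<open>\<Omega>\<close> is closed and misses the frontier,
    so \<open>O' - L\<close> is still a neighbourhood of the frontier point \<open>x\<close> and
    meets \<open>\<Omega>\<close>.\<close>
  have not_sub: "\<not> \<Omega> \<inter> O' \<subseteq> L" if O': "openin X O'" and x: "x \<in> O'" "x \<in> X frontier_of \<Omega>" for O' x
  proof -
    have "openin X (O' - L)"
      by (rule openin_diff[OF O' compactin_imp_closedin[OF H L'(1)]])
    moreover have "x \<in> O' - L" "x \<in> X closure_of \<Omega>" using x L'(2) front by blast+
    ultimately show ?thesis unfolding in_closure_of by blast
  qed
  obtain x1 x2 where "x1 \<in> O1" "x1 \<in> X frontier_of \<Omega>" "x2 \<in> O2" "x2 \<in> X frontier_of \<Omega>"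
    using O(3,4) E(4,5,6) by blast
  then show False using L(2) not_sub O(1,2) by blast
qed

end
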